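(* There is an isomorphism of $\mathbb{Z}^n$-graded algebras $\mathrm{Cl}_q(n,k)\cong \mathrm{Cl}_q(1,k)^{\otimes n}$ (ordinary tensor product of $\mathbb{k}$-algebras).
   Context: Let $\mathbb{k}$ be a field of characteristic different from $2$, let $q\in\mathbb{k}^\times$, and let $N,k$ be positive integers. The quantum Clifford algebra $\mathrm{Cl}_q(N,k)$ is the unital associative $\mathbb{k}$-algebra generated by $\psi_a,\psi_a^*,\omega_a,\omega_a^{-1}$ for $a\in\{1,\dots,N\}$, subject to the relations (for all $a,b\in\{1,\dots,N\}$): $\omega_a\omega_b=\omega_b\omega_a$; $\omega_a\omega_a^{-1}=1$; $\omega_a\psi_b=q^{\delta_{ab}}\psi_b\omega_a$; $\omega_a\psi_b^*=q^{-\delta_{ab}}\psi_b^*\omega_a$; $\psi_a\psi_b+\psi_b\psi_a=0$; $\psi_a^*\psi_b^*+\psi_b^*\psi_a^*=0$; $\psi_a\psi_a^*+q^k\psi_a^*\psi_a=\omega_a^{-k}$; $\psi_a\psi_a^*+q^{-k}\psi_a^*\psi_a=\omega_a^{k}$; and $\psi_a\psi_b^*+\psi_b^*\psi_a=0$ if $a\neq b$. It carries a $\mathbb{Z}^N$-grading with $\deg\psi_a=e_a$, $\deg\psi_a^*=-e_a$, $\deg\omega_a=0$. The tensor power $\mathrm{Cl}_q(1,k)^{\otimes n}$ is $\mathbb{Z}^n$-graded by giving the $j$th factor degrees in $\mathbb{Z}e_j$. *)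

theory Defs
  imports "HOL-Algebra.Algebra"
begin

definition malg_mult :: "('m \<Rightarrow> 'm \<Rightarrow> 'm) \<Rightarrow> ('m \<Rightarrow> 'k::field) \<Rightarrow> ('m \<Rightarrow> 'k) \<Rightarrow> 'm \<Rightarrow> 'k" where
  "malg_mult m f g z =
     (\<Sum>(x, y) \<in> {x. f x \<noteq> 0} \<times> {y. g y \<noteq> 0}. if m x y = z then f x * g y else 0)"

definition malg :: "'m set \<Rightarrow> ('m \<Rightarrow> 'm \<Rightarrow> 'm) \<Rightarrow> 'm \<Rightarrow> ('k::field, 'm \<Rightarrow> 'k) module" where
  "malg M m e =
     \<lparr>carrier = {f. finite {x. f x \<noteq> 0} \<and> {x. f x \<noteq> 0} \<subseteq> M},
      monoid.mult = malg_mult m,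
      monoid.one = (\<lambda>x. if x = e then 1 else 0),
      ring.zero = (\<lambda>_. 0),
      ring.add = (\<lambda>f g x. f x + g x),
      module.smult = (\<lambda>c f x. c * f x)\<rparr>"

definition delta :: "'m \<Rightarrow> 'm \<Rightarrow> 'k::field" where
  "delta u = (\<lambda>s. if s = u then 1 else 0)"

definition qalg :: "('k, 'a) module \<Rightarrow> 'a set \<Rightarrow> ('k, 'a set) module" where
  "qalg A I =
     \<lparr>carrier = carrier (A Quot I),
      monoid.mult = monoid.mult (A Quot I),
      monoid.one = monoid.one (A Quot I),
      ring.zero = ring.zero (A Quot I),
      ring.add = ring.add (A Quot I),
      module.smult = (\<lambda>c C. a_r_coset A I (module.smult A c (SOME x. x \<in> C)))\<rparr>"

definition qcomp :: "('k::field, 'm \<Rightarrow> 'k) module \<Rightarrow> ('m \<Rightarrow> 'k) set \<Rightarrow> ('m \<Rightarrow> bool) \<Rightarrow> ('m \<Rightarrow> 'k) set set" where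
  "qcomp A I P = {a_r_coset A I f | f. f \<in> carrier A \<and> (\<forall>x. f x \<noteq> 0 \<longrightarrow> P x)}"

datatype gen = Psi nat | PsiS nat | Om nat | OmI nat

definition gens :: "nat \<Rightarrow> gen set" where
  "gens N = (\<Union>a\<in>{1..N}. {Psi a, PsiS a, Om a, OmI a})"

definition free_alg :: "gen set \<Rightarrow> ('k::field, gen list \<Rightarrow> 'k) module" where
  "free_alg G = malg {w. set w \<subseteq> G} (@) []"

definition mono :: "gen list \<Rightarrow> gen list \<Rightarrow> 'k::field" where
  "mono w = delta w"

definition cl_rels :: "nat \<Rightarrow> 'k::field \<Rightarrow> nat \<Rightarrow> (gen list \<Rightarrow> 'k) set" where
  "cl_rels N q k =
     {(\<lambda>w. mono [Om a, Om b] w - mono [Om b, Om a] w) | a b. a \<in> {1..N} \<and> b \<in> {1..N}}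
   \<union> {(\<lambda>w. mono [Om a, OmI a] w - mono [] w) | a. a \<in> {1..N}}
   \<union> {(\<lambda>w. mono [OmI a, Om a] w - mono [] w) | a. a \<in> {1..N}}
   \<union> {(\<lambda>w. mono [Om a, Psi b] w - (if a = b then q else 1) * mono [Psi b, Om a] w)
       | a b. a \<in> {1..N} \<and> b \<in> {1..N}}
   \<union> {(\<lambda>w. mono [Om a, PsiS b] w - (if a = b then inverse q else 1) * mono [PsiS b, Om a] w)
       | a b. a \<in> {1..N} \<and> b \<in> {1..N}}
   \<union> {(\<lambda>w. mono [Psi a, Psi b] w + mono [Psi b, Psi a] w) | a b. a \<in> {1..N} \<and> b \<in> {1..N}}
   \<union> {(\<lambda>w. mono [PsiS a, PsiS b] w + mono [PsiS b, PsiS a] w) | a b. a \<in> {1..N} \<and> b \<in> {1..N}}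
   \<union> {(\<lambda>w. mono [Psi a, PsiS a] w + q ^ k * mono [PsiS a, Psi a] w - mono (replicate k (OmI a)) w)
       | a. a \<in> {1..N}}
   \<union> {(\<lambda>w. mono [Psi a, PsiS a] w + inverse q ^ k * mono [PsiS a, Psi a] w - mono (replicate k (Om a)) w)
       | a. a \<in> {1..N}}
   \<union> {(\<lambda>w. mono [Psi a, PsiS b] w + mono [PsiS b, Psi a] w) | a b. a \<in> {1..N} \<and> b \<in> {1..N} \<and> a \<noteq> b}"

definition cl_ideal :: "nat \<Rightarrow> 'k::field \<Rightarrow> nat \<Rightarrow> (gen list \<Rightarrow> 'k) set" where
  "cl_ideal N q k = genideal (free_alg (gens N)) (cl_rels N q k)"

definition Cl :: "'k::field \<Rightarrow> nat \<Rightarrow> nat \<Rightarrow> ('k, (gen list \<Rightarrow> 'k) set) module" where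
  "Cl q N k = qalg (free_alg (gens N)) (cl_ideal N q k)"

text \<open>Z^N-degree of a word (degrees as functions nat => int supported in {1..N}).\<close>
definition wdeg :: "gen list \<Rightarrow> nat \<Rightarrow> int" where
  "wdeg w a = int (length (filter (\<lambda>g. g = Psi a) w)) - int (length (filter (\<lambda>g. g = PsiS a) w))"

definition cl_comp :: "'k::field \<Rightarrow> nat \<Rightarrow> nat \<Rightarrow> (nat \<Rightarrow> int) \<Rightarrow> (gen list \<Rightarrow> 'k) set set" where
  "cl_comp q N k d = qcomp (free_alg (gens N)) (cl_ideal N q k) (\<lambda>w. wdeg w = d)"

text \<open>A^{\<otimes>n}: free vector space on n-tuples (lists of length n) of elements of A,
  with componentwise product on tuples, modulo the multilinearity relations.\<close>

definition tuples :: "('k, 'a) module \<Rightarrow> nat \<Rightarrow> 'a list set" where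
  "tuples A n = {t. length t = n \<and> set t \<subseteq> carrier A}"

definition tuple_alg :: "('k::field, 'a) module \<Rightarrow> nat \<Rightarrow> ('k, 'a list \<Rightarrow> 'k) module" where
  "tuple_alg A n = malg (tuples A n) (\<lambda>s t. map (\<lambda>(x, y). x \<otimes>\<^bsub>A\<^esub> y) (zip s t)) (replicate n \<one>\<^bsub>A\<^esub>)"

definition mlin_rels :: "('k::field, 'a) module \<Rightarrow> nat \<Rightarrow> ('a list \<Rightarrow> 'k) set" where
  "mlin_rels A n =
     {(\<lambda>s. delta (t[j := x \<oplus>\<^bsub>A\<^esub> y]) s - delta (t[j := x]) s - delta (t[j := y]) s)
       | t j x y. t \<in> tuples A n \<and> j < n \<and> x \<in> carrier A \<and> y \<in> carrier A}
   \<union> {(\<lambda>s. delta (t[j := module.smult A c x]) s - c * delta (t[j := x]) s)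
       | t j c x. t \<in> tuples A n \<and> j < n \<and> x \<in> carrier A}"

definition tens_ideal :: "('k::field, 'a) module \<Rightarrow> nat \<Rightarrow> ('a list \<Rightarrow> 'k) set" where
  "tens_ideal A n = genideal (tuple_alg A n) (mlin_rels A n)"

definition tens_pow :: "('k::field, 'a) module \<Rightarrow> nat \<Rightarrow> ('k, ('a list \<Rightarrow> 'k) set) module" where
  "tens_pow A n = qalg (tuple_alg A n) (tens_ideal A n)"

text \<open>Z^n-grading of Cl_q(1,k)^{\<otimes>n}: the j-th factor (list position j, i.e. factor j+1)
  is graded in Z e_{j+1}.  Component of degree d = span of pure tensors a_1 \<otimes> ... \<otimes> a_n with
  a_j homogeneous of degree d_j in Cl_q(1,k).\<close>
definition tens_comp :: "'k::field \<Rightarrow> nat \<Rightarrow> nat \<Rightarrow> (nat \<Rightarrow> int)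
    \<Rightarrow> ((gen list \<Rightarrow> 'k) set list \<Rightarrow> 'k) set set" where
  "tens_comp q n k d =
     qcomp (tuple_alg (Cl q 1 k) n) (tens_ideal (Cl q 1 k) n)
       (\<lambda>t. \<forall>j<n. t ! j \<in> cl_comp q 1 k (\<lambda>b. if b = 1 then d (Suc j) else 0))"

definition graded_alg_iso ::
  "('k, 'a) module \<Rightarrow> ('k, 'b) module \<Rightarrow> nat \<Rightarrow> ((nat \<Rightarrow> int) \<Rightarrow> 'a set)
     \<Rightarrow> ((nat \<Rightarrow> int) \<Rightarrow> 'b set) \<Rightarrow> ('a \<Rightarrow> 'b) \<Rightarrow> bool" where
  "graded_alg_iso A B n CA CB f \<longleftrightarrow>
     f \<in> ring_iso A B \<and>
     (\<forall>c. \<forall>x \<in> carrier A. f (module.smult A c x) = module.smult B c (f x)) \<and>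
     (\<forall>d. (\<forall>a. d a \<noteq> 0 \<longrightarrow> a \<in> {1..n}) \<longrightarrow> f ` CA d = CB d)"

end

theory Submission
  imports Defs
begin

text \<open>
  In $\mathrm{Cl}_q(1,k)$ the element $E = \omega^k \psi \psi^*$ is an idempotent with $E\psi = \psi$,
  $\psi E = 0$, $\psi^* E = \psi^*$ and $E \psi^* = 0$, so $s = 2E - 1$ is an involution of degree zero
  which commutes with $\omega$ and anticommutes with $\psi$ and $\psi^*$. Multiplying the odd generators
  of index $a$ by $s_1 \cdots s_{a-1}$ (the Jordan--Wigner twist) exchanges anticommutation with
  commutation between different indices and leaves the relations at a single index intact. Hence
  the twist defines mutually inverse homomorphisms between $\mathrm{Cl}_q(n,k)$ and
  $\mathrm{Cl}_q(1,k)^{\otimes n}$, and both preserve degrees because $s$ has degree zero.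
\<close>

section \<open>Algebras over a field\<close>

text \<open>The obstacle is a sign: odd generators of different indices anticommute in
  \<open>Cl q n k\<close>, while different slots of an ordinary tensor product commute. It can be
  removed because the parity automorphism of \<open>Cl q 1 k\<close> is inner, being conjugation by
  s. The formula for E comes from multiplying psi psi* + q^k psi* psi = omega^(-k) by psi on the
  right: as psi^2 = 0, this leaves psi psi* psi = omega^(-k) psi, so omega^k psi psi* is a left unit
  for psi. The relation with equal indices reads 2 psi^2 = 0, so psi^2 = 0 already depends on the
  characteristic. The string s_1 ... s_(a-1) stops before a. It therefore commutes with every
  generator of index a, and in a product of two odd generators of index a its two copies cancel.
  Hence s_a comes out the same from twisted and untwisted generators, and repeating the twist undoes
  it. This is why two homomorphisms given by the same formula are mutually inverse. No basis or
  dimension count occurs: both maps come from universal properties, and both composites are compared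
  with the identity on generators or pure tensors.\<close>

locale kalg = ring A for A :: "('k::field, 'a) module" (structure) +
  assumes smult_closed [intro, simp]: "x \<in> carrier A \<Longrightarrow> c \<odot> x \<in> carrier A"
    and smult_l_distr: "x \<in> carrier A \<Longrightarrow> (c + d) \<odot> x = c \<odot> x \<oplus> d \<odot> x"
    and smult_r_distr: "x \<in> carrier A \<Longrightarrow> y \<in> carrier A \<Longrightarrow> c \<odot> (x \<oplus> y) = c \<odot> x \<oplus> c \<odot> y"
    and smult_assoc: "x \<in> carrier A \<Longrightarrow> c \<odot> (d \<odot> x) = (c * d) \<odot> x"
    and smult_one [simp]: "x \<in> carrier A \<Longrightarrow> 1 \<odot> x = x"
    and smult_mult_left: "x \<in> carrier A \<Longrightarrow> y \<in> carrier A \<Longrightarrow> (c \<odot> x) \<otimes> y = c \<odot> (x \<otimes> y)"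
    and smult_mult_right: "x \<in> carrier A \<Longrightarrow> y \<in> carrier A \<Longrightarrow> x \<otimes> (c \<odot> y) = c \<odot> (x \<otimes> y)"
begin

lemma smult_zero_left [simp]: "x \<in> carrier A \<Longrightarrow> 0 \<odot> x = \<zero>"
  by (metis add.l_cancel_one add_0 smult_closed smult_l_distr)

lemma smult_zero_right [simp]: "c \<odot> \<zero> = \<zero>"
  by (metis add.l_cancel_one l_zero smult_closed smult_r_distr zero_closed)

lemma smult_minus_left: "x \<in> carrier A \<Longrightarrow> (- c) \<odot> x = \<ominus> (c \<odot> x)"
  by (metis minus_equality add.left_inverse smult_closed smult_l_distr smult_zero_left)

lemma smult_minus_right: "x \<in> carrier A \<Longrightarrow> c \<odot> (\<ominus> x) = \<ominus> (c \<odot> x)"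
  by (metis a_inv_closed l_neg minus_equality smult_closed smult_r_distr smult_zero_right)

lemma smult_diff: "x \<in> carrier A \<Longrightarrow> y \<in> carrier A \<Longrightarrow> c \<odot> (x \<ominus> y) = c \<odot> x \<ominus> c \<odot> y"
  by (simp add: a_minus_def smult_r_distr smult_minus_right)

text \<open>Scalars sit inside the algebra as multiples of the unit, so a two-sided ring ideal is
  automatically a subspace. This is why the purely ring-theoretic \<open>genideal\<close> gives the
  correct quotient algebras.\<close>

lemma ideal_smult:
  assumes "ideal I A" "x \<in> I"
  shows "c \<odot> x \<in> I"
proof -
  have x: "x \<in> carrier A"
    using assms ideal.Icarr by metis
  have "(c \<odot> \<one>) \<otimes> x \<in> I"
    using assms by (simp add: ideal.I_l_closed)
  then show ?thesis
    using x by (simp add: smult_mult_left)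
qed

end

definition alg_hom :: "('k, 'a) module \<Rightarrow> ('k, 'b) module \<Rightarrow> ('a \<Rightarrow> 'b) \<Rightarrow> bool" where
  "alg_hom A B h \<longleftrightarrow> h \<in> ring_hom A B \<and>
     (\<forall>c. \<forall>x \<in> carrier A. h (c \<odot>\<^bsub>A\<^esub> x) = c \<odot>\<^bsub>B\<^esub> h x)"

lemma alg_homI:
  assumes "\<And>x. x \<in> carrier A \<Longrightarrow> h x \<in> carrier B"
    and "\<And>x y. x \<in> carrier A \<Longrightarrow> y \<in> carrier A \<Longrightarrow> h (x \<otimes>\<^bsub>A\<^esub> y) = h x \<otimes>\<^bsub>B\<^esub> h y"
    and "\<And>x y. x \<in> carrier A \<Longrightarrow> y \<in> carrier A \<Longrightarrow> h (x \<oplus>\<^bsub>A\<^esub> y) = h x \<oplus>\<^bsub>B\<^esub> h y"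
    and "h \<one>\<^bsub>A\<^esub> = \<one>\<^bsub>B\<^esub>"
    and "\<And>c x. x \<in> carrier A \<Longrightarrow> h (c \<odot>\<^bsub>A\<^esub> x) = c \<odot>\<^bsub>B\<^esub> h x"
  shows "alg_hom A B h"
  using assms by (auto simp: alg_hom_def intro: ring_hom_memI)

lemma alg_hom_closed: "alg_hom A B h \<Longrightarrow> x \<in> carrier A \<Longrightarrow> h x \<in> carrier B"
  by (auto simp: alg_hom_def intro: ring_hom_closed)

lemma alg_hom_mult:
  "alg_hom A B h \<Longrightarrow> x \<in> carrier A \<Longrightarrow> y \<in> carrier A \<Longrightarrow> h (x \<otimes>\<^bsub>A\<^esub> y) = h x \<otimes>\<^bsub>B\<^esub> h y"
  by (simp add: alg_hom_def ring_hom_mult)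

lemma alg_hom_add:
  "alg_hom A B h \<Longrightarrow> x \<in> carrier A \<Longrightarrow> y \<in> carrier A \<Longrightarrow> h (x \<oplus>\<^bsub>A\<^esub> y) = h x \<oplus>\<^bsub>B\<^esub> h y"
  by (simp add: alg_hom_def ring_hom_add)

lemma alg_hom_one: "alg_hom A B h \<Longrightarrow> h \<one>\<^bsub>A\<^esub> = \<one>\<^bsub>B\<^esub>"
  by (simp add: alg_hom_def ring_hom_one)

lemma alg_hom_smult: "alg_hom A B h \<Longrightarrow> x \<in> carrier A \<Longrightarrow> h (c \<odot>\<^bsub>A\<^esub> x) = c \<odot>\<^bsub>B\<^esub> h x"
  by (simp add: alg_hom_def)

lemma alg_hom_zero: "kalg A \<Longrightarrow> kalg B \<Longrightarrow> alg_hom A B h \<Longrightarrow> h \<zero>\<^bsub>A\<^esub> = \<zero>\<^bsub>B\<^esub>"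
  by (simp add: alg_hom_def ring_hom_zero kalg_def)

lemma alg_hom_diff:
  assumes "kalg A" "kalg B" "alg_hom A B h" "x \<in> carrier A" "y \<in> carrier A"
  shows "h (x \<ominus>\<^bsub>A\<^esub> y) = h x \<ominus>\<^bsub>B\<^esub> h y"
proof -
  interpret A: kalg A by fact
  interpret B: kalg B by fact
  interpret h: ring_hom_ring A B h
    by (intro ring_hom_ringI2 A.ring_axioms B.ring_axioms) (use assms(3) in \<open>simp add: alg_hom_def\<close>)
  show ?thesis
    using assms(4,5) by (simp add: a_minus_def)
qed

lemma alg_hom_pow:
  assumes "kalg A" "kalg B" "alg_hom A B h" "x \<in> carrier A"
  shows "h (x [^]\<^bsub>A\<^esub> (m::nat)) = h x [^]\<^bsub>B\<^esub> m"
proof -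
  interpret A: kalg A by fact
  show ?thesis
    by (induction m) (use assms in \<open>auto simp: alg_hom_one alg_hom_mult\<close>)
qed

lemma alg_hom_comp: "alg_hom A B g \<Longrightarrow> alg_hom B C h \<Longrightarrow> alg_hom A C (\<lambda>x. h (g x))"
  by (rule alg_homI)
    (simp_all add: alg_hom_closed alg_hom_mult alg_hom_add alg_hom_one alg_hom_smult)

section \<open>Quotient algebras\<close>

text \<open>\<open>qalg A I\<close> is a record of its own that agrees with \<open>A Quot I\<close>
  only field by field; this carries the ring axioms over.\<close>

lemma ring_cong:
  assumes "ring R" "carrier S = carrier R" "monoid.mult S = monoid.mult R"
    "monoid.one S = monoid.one R" "ring.add S = ring.add R" "ring.zero S = ring.zero R"
  shows "ring S"
proof -
  interpret R: ring R by fact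
  show ?thesis
    by (intro ringI abelian_groupI monoidI, unfold assms(2-))
      (simp_all add: R.m_assoc R.a_assoc R.l_distr R.r_distr R.a_ac R.add.l_inv_ex[simplified])
qed

lemma qalg_simps:
  "carrier (qalg A I) = carrier (A Quot I)"
  "monoid.mult (qalg A I) = monoid.mult (A Quot I)"
  "monoid.one (qalg A I) = monoid.one (A Quot I)"
  "ring.zero (qalg A I) = ring.zero (A Quot I)"
  "ring.add (qalg A I) = ring.add (A Quot I)"
  by (simp_all add: qalg_def)

context kalg begin

lemma qalg_ring: "ideal I A \<Longrightarrow> ring (qalg A I)"
  by (rule ring_cong[of "A Quot I"]) (simp_all add: qalg_simps ideal.quotient_is_ring)

lemma coset_eq_iff:
  assumes "ideal I A" "x \<in> carrier A" "y \<in> carrier A"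
  shows "I +> x = I +> y \<longleftrightarrow> x \<ominus> y \<in> I"
proof -
  interpret I: ideal I A by fact
  show ?thesis using assms(2,3) quotient_eq_iff_same_a_r_cos[OF assms(1)] by blast
qed

text \<open>The scalar action on cosets is defined through a \<open>SOME\<close> representative. Two
  representatives differ by an element of the ideal, and \<open>ideal_smult\<close> keeps that
  difference in the ideal.\<close>

lemma qalg_smult:
  assumes "ideal I A" "x \<in> carrier A"
  shows "c \<odot>\<^bsub>qalg A I\<^esub> (I +> x) = I +> (c \<odot> x)"
proof -
  interpret I: ideal I A by fact
  define y where "y = (SOME y. y \<in> I +> x)"
  have "x \<in> I +> x"
    using assms(2) by (metis I.a_rcos_self)
  then have y: "y \<in> I +> x"
    unfolding y_def by (rule someI)
  then have yc: "y \<in> carrier A"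
    using assms(2) I.a_elemrcos_carrier by blast
  have "I +> x = I +> y"
    using I.a_repr_independence' y assms(2) by blast
  then have "y \<ominus> x \<in> I"
    using coset_eq_iff[OF assms(1) yc assms(2)] by simp
  then have "c \<odot> y \<ominus> c \<odot> x \<in> I"
    using ideal_smult[OF assms(1)] smult_diff yc assms(2) by metis
  then show ?thesis
    using yc assms coset_eq_iff[OF assms(1)] by (simp add: qalg_def y_def)
qed

lemma qalg_carrierE:
  assumes "C \<in> carrier (qalg A I)"
  obtains x where "x \<in> carrier A" "C = I +> x"
  using assms by (auto simp: qalg_simps FactRing_def A_RCOSETS_def' )

lemma coset_in_qalg: "x \<in> carrier A \<Longrightarrow> I +> x \<in> carrier (qalg A I)"
  by (auto simp: qalg_simps FactRing_def A_RCOSETS_def')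

lemma qalg_mult:
  "ideal I A \<Longrightarrow> x \<in> carrier A \<Longrightarrow> y \<in> carrier A \<Longrightarrow> (I +> x) \<otimes>\<^bsub>qalg A I\<^esub> (I +> y) = I +> (x \<otimes> y)"
  by (simp add: qalg_simps FactRing_def ideal.rcoset_mult_add)

lemma qalg_add:
  assumes "ideal I A" "x \<in> carrier A" "y \<in> carrier A"
  shows "(I +> x) \<oplus>\<^bsub>qalg A I\<^esub> (I +> y) = I +> (x \<oplus> y)"
proof -
  interpret I: ideal I A by fact
  show ?thesis
    using assms(2,3) by (simp add: qalg_simps FactRing_def I.a_rcos_sum)
qed

lemma qalg_one: "\<one>\<^bsub>qalg A I\<^esub> = I +> \<one>"
  by (simp add: qalg_simps FactRing_def)

lemma qalg_kalg:
  assumes "ideal I A"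
  shows "kalg (qalg A I)"
proof -
  interpret Q: ring "qalg A I" by (rule qalg_ring) fact
  show ?thesis
    by unfold_locales
      (auto elim!: qalg_carrierE
        simp: assms qalg_smult qalg_mult qalg_add coset_in_qalg smult_l_distr smult_r_distr
          smult_assoc smult_mult_left smult_mult_right)
qed

lemma qalg_proj: "ideal I A \<Longrightarrow> alg_hom A (qalg A I) (\<lambda>x. I +> x)"
  by (rule alg_homI) (simp_all add: qalg_smult qalg_mult qalg_add coset_in_qalg qalg_one)

lemma coset_zero_iff:
  assumes "ideal I A" "x \<in> carrier A"
  shows "I +> x = \<zero>\<^bsub>qalg A I\<^esub> \<longleftrightarrow> x \<in> I"
proof -
  interpret I: ideal I A by fact
  show ?thesis
    using assms(2) I.a_rcos_const I.rcos_const_imp_mem by (auto simp: qalg_simps FactRing_def)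
qed

text \<open>Universal property of a presentation: the kernel of \<open>h\<close> is an ideal
  containing \<open>S\<close>, hence contains the ideal generated by \<open>S\<close>, so
  \<open>h\<close> is constant on cosets.\<close>

lemma qalg_factor:
  assumes B: "kalg B" and h: "alg_hom A B h" and S: "S \<subseteq> carrier A"
    and 0: "\<And>r. r \<in> S \<Longrightarrow> h r = \<zero>\<^bsub>B\<^esub>"
  shows "\<exists>h'. alg_hom (qalg A (genideal A S)) B h' \<and> (\<forall>x \<in> carrier A. h' (genideal A S +> x) = h x)"
proof -
  let ?I = "genideal A S"
  interpret B: kalg B by (rule B)
  interpret h: ring_hom_ring A B h
    by (intro ring_hom_ringI2 ring_axioms B.ring_axioms) (use h in \<open>simp add: alg_hom_def\<close>)
  have I: "ideal ?I A"
    by (rule genideal_ideal[OF S])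
  have "?I \<subseteq> a_kernel A B h"
  proof (rule genideal_minimal[OF h.kernel_is_ideal], rule subsetI)
    fix r assume "r \<in> S"
    then show "r \<in> a_kernel A B h"
      using S 0 unfolding a_kernel_def' by blast
  qed
  then have ker: "h x = \<zero>\<^bsub>B\<^esub>" if "x \<in> ?I" for x
    using that unfolding a_kernel_def' by blast
  \<comment> \<open>An arbitrary representative is chosen; \<open>ker\<close> makes the value
    independent of the choice.\<close>
  define h' where "h' C = h (SOME x. x \<in> carrier A \<and> ?I +> x = C)" for C
  have h': "h' (?I +> x) = h x" if x: "x \<in> carrier A" for x
  proof -
    define y where "y = (SOME y. y \<in> carrier A \<and> ?I +> y = ?I +> x)"
    have y: "y \<in> carrier A" "?I +> y = ?I +> x"
      using someI[of "\<lambda>y. y \<in> carrier A \<and> ?I +> y = ?I +> x" x] x by (simp_all add: y_def)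
    then have "h (y \<ominus> x) = \<zero>\<^bsub>B\<^esub>"
      using ker coset_eq_iff[OF I] x by blast
    then have "h y = h x"
      using x y alg_hom_diff[OF kalg_axioms B h] by simp
    then show ?thesis
      by (simp add: h'_def y_def)
  qed
  have "alg_hom (qalg A ?I) B h'"
    by (rule alg_homI)
      (auto elim!: qalg_carrierE simp: h' I qalg_smult qalg_mult qalg_add qalg_one
        h.hom_mult h.hom_add alg_hom_smult[OF h])
  then show ?thesis
    using h' by blast
qed

end

section \<open>Monoid algebras\<close>

locale set_monoid =
  fixes M :: "'m set" and m :: "'m \<Rightarrow> 'm \<Rightarrow> 'm" and e :: 'm
  assumes m_in: "x \<in> M \<Longrightarrow> y \<in> M \<Longrightarrow> m x y \<in> M"
    and e_in: "e \<in> M"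
    and assoc: "x \<in> M \<Longrightarrow> y \<in> M \<Longrightarrow> z \<in> M \<Longrightarrow> m (m x y) z = m x (m y z)"
    and e_left: "x \<in> M \<Longrightarrow> m e x = x"
    and e_right: "x \<in> M \<Longrightarrow> m x e = x"

lemma malg_carrier_iff:
  "f \<in> carrier (malg M m e) \<longleftrightarrow> finite {x. f x \<noteq> 0} \<and> {x. f x \<noteq> 0} \<subseteq> M"
  by (simp add: malg_def)

lemma malg_ops:
  "monoid.mult (malg M m e) = malg_mult m"
  "monoid.one (malg M m e) = delta e"
  "ring.zero (malg M m e) = (\<lambda>_. 0)"
  "ring.add (malg M m e) = (\<lambda>f g x. f x + g x)"
  "module.smult (malg M m e) = (\<lambda>c f x. c * f x)"
  by (simp_all add: malg_def delta_def)

lemma delta_in: "u \<in> M \<Longrightarrow> delta u \<in> carrier (malg M m e)"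
  by (simp add: malg_carrier_iff delta_def)

lemma malg_add_in:
  "f \<in> carrier (malg M m e) \<Longrightarrow> g \<in> carrier (malg M m e) \<Longrightarrow> (\<lambda>x. f x + g x) \<in> carrier (malg M m e)"
  by (auto simp: malg_carrier_iff subset_iff intro: finite_subset[of _ "{x. f x \<noteq> 0} \<union> {x. g x \<noteq> 0}"])
    (metis add_0)

lemma malg_smult_in: "f \<in> carrier (malg M m e) \<Longrightarrow> (\<lambda>x. c * f x) \<in> carrier (malg M m e)"
  by (auto simp: malg_carrier_iff intro: finite_subset[of _ "{x. f x \<noteq> 0}"])

lemma malg_diff_in:
  assumes "f \<in> carrier (malg M m e)" "g \<in> carrier (malg M m e)"
  shows "(\<lambda>x. f x - g x) \<in> carrier (malg M m e)"
  using malg_add_in[OF assms(1) malg_smult_in[OF assms(2), of "- 1"]] by simp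

text \<open>The product is defined by a sum over the exact supports, which change under addition and
  scaling. Over common finite supersets bilinearity becomes a termwise identity.\<close>

lemma malg_mult_superset:
  assumes "finite U" "{x. f x \<noteq> 0} \<subseteq> U" "finite Y" "{y. g y \<noteq> 0} \<subseteq> Y"
  shows "malg_mult m f g z = (\<Sum>x\<in>U. \<Sum>y\<in>Y. if m x y = z then f x * g y else 0)"
proof -
  have "malg_mult m f g z = (\<Sum>(x, y)\<in>U \<times> Y. if m x y = z then f x * g y else 0)"
    unfolding malg_mult_def using assms
    by (intro sum.mono_neutral_left) (auto split: if_splits)
  then show ?thesis
    by (simp add: sum.cartesian_product)
qed

lemma malg_mult_delta: "malg_mult m (delta x) (delta y) = (delta (m x y) :: _ \<Rightarrow> 'k::field)"
  by (rule ext, subst malg_mult_superset[of "{x}" _ "{y}"]) (auto simp: delta_def)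

lemma malg_mult_add_left:
  assumes "finite {x. f x \<noteq> 0}" "finite {x. f' x \<noteq> 0}" "finite {x. g x \<noteq> 0}"
  shows "malg_mult m (\<lambda>x. f x + f' x) g = (\<lambda>x. malg_mult m f g x + malg_mult m f' g x)"
proof (rule ext)
  fix z
  let ?U = "{x. f x \<noteq> 0} \<union> {x. f' x \<noteq> 0}" and ?Y = "{x. g x \<noteq> 0}"
  show "malg_mult m (\<lambda>x. f x + f' x) g z = malg_mult m f g z + malg_mult m f' g z"
    using assms
    by (subst (1 2 3) malg_mult_superset[of ?U _ ?Y])
      (auto simp: sum.distrib[symmetric] distrib_right intro!: sum.cong)
qed

lemma malg_mult_add_right:
  assumes "finite {x. f x \<noteq> 0}" "finite {x. g x \<noteq> 0}" "finite {x. g' x \<noteq> 0}"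
  shows "malg_mult m f (\<lambda>x. g x + g' x) = (\<lambda>x. malg_mult m f g x + malg_mult m f g' x)"
proof (rule ext)
  fix z
  let ?U = "{x. f x \<noteq> 0}" and ?Y = "{x. g x \<noteq> 0} \<union> {x. g' x \<noteq> 0}"
  show "malg_mult m f (\<lambda>x. g x + g' x) z = malg_mult m f g z + malg_mult m f g' z"
    using assms
    by (subst (1 2 3) malg_mult_superset[of ?U _ ?Y])
      (auto simp: sum.distrib[symmetric] distrib_left intro!: sum.cong)
qed

lemma malg_mult_smult_left:
  assumes "finite {x. f x \<noteq> 0}" "finite {x. g x \<noteq> 0}"
  shows "malg_mult m (\<lambda>x. c * f x) g = (\<lambda>x. c * malg_mult m f g x)"
  using assms
  by (intro ext, subst (1 2) malg_mult_superset[of "{x. f x \<noteq> 0}" _ "{x. g x \<noteq> 0}"])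
    (auto simp: sum_distrib_left intro!: sum.cong)

lemma malg_mult_smult_right:
  assumes "finite {x. f x \<noteq> 0}" "finite {x. g x \<noteq> 0}"
  shows "malg_mult m f (\<lambda>x. c * g x) = (\<lambda>x. c * malg_mult m f g x)"
  using assms
  by (intro ext, subst (1 2) malg_mult_superset[of "{x. f x \<noteq> 0}" _ "{x. g x \<noteq> 0}"])
    (auto simp: sum_distrib_left intro!: sum.cong)

text \<open>Finitely supported functions are linear combinations of \<open>delta\<close>s, so a
  property stable under adding a multiple of a \<open>delta\<close> reduces to basis elements. All
  extensions by linearity below go through this rule.\<close>

lemma malg_induct [consumes 1, case_names zero step]:
  fixes f :: "'m \<Rightarrow> 'k::field"
  assumes "f \<in> carrier (malg M m e)"
    and "P (\<lambda>_. 0)"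
    and "\<And>f u c. f \<in> carrier (malg M m e) \<Longrightarrow> u \<in> M \<Longrightarrow> P f \<Longrightarrow> P (\<lambda>x. f x + c * delta u x)"
  shows "P f"
proof -
  have "finite U \<Longrightarrow> {x. f x \<noteq> 0} \<subseteq> U \<Longrightarrow> U \<subseteq> M \<Longrightarrow> P f" for U and f :: "'m \<Rightarrow> 'k"
  proof (induction U arbitrary: f rule: finite_induct)
    case empty
    then have "f = (\<lambda>_. 0)"
      by auto
    then show ?case
      using assms(2) by simp
  next
    case (insert u U)
    let ?g = "f(u := 0)"
    have sub: "{x. ?g x \<noteq> 0} \<subseteq> U"
      using insert by auto
    then have "?g \<in> carrier (malg M m e)"
      using insert by (auto simp: malg_carrier_iff intro: finite_subset)
    moreover have "P ?g"
      using insert sub by blast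
    ultimately have "P (\<lambda>x. ?g x + f u * delta u x)"
      using insert assms(3) by blast
    moreover have "(\<lambda>x. ?g x + f u * delta u x) = f"
      by (auto simp: delta_def)
    ultimately show ?case
      by simp
  qed
  then show ?thesis
    using assms(1) by (auto simp: malg_carrier_iff)
qed

context set_monoid begin

lemma malg_mult_in:
  assumes "f \<in> carrier (malg M m e)" "g \<in> carrier (malg M m e)"
  shows "malg_mult m f g \<in> carrier (malg M m e)"
proof -
  let ?Z = "(\<lambda>(x, y). m x y) ` ({x. f x \<noteq> 0} \<times> {y. g y \<noteq> 0})"
  have "finite ?Z" "?Z \<subseteq> M"
    using assms m_in by (auto simp: malg_carrier_iff)
  moreover have "malg_mult m f g z = 0" if "z \<notin> ?Z" for z
    unfolding malg_mult_def using that by (intro sum.neutral) auto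
  then have "{z. malg_mult m f g z \<noteq> 0} \<subseteq> ?Z"
    by blast
  ultimately show ?thesis
    unfolding malg_carrier_iff by (meson finite_subset subset_trans)
qed

lemmas malg_bilinear = malg_mult_add_left malg_mult_add_right malg_mult_smult_left malg_mult_smult_right

lemma malg_finite: "f \<in> carrier (malg M m e) \<Longrightarrow> finite {x. f x \<noteq> 0}"
  by (simp add: malg_carrier_iff)

lemma malg_mult_zero: "malg_mult m (\<lambda>_. 0) f = (\<lambda>_. 0)" "malg_mult m f (\<lambda>_. 0) = (\<lambda>_. 0)"
  by (auto simp: malg_mult_def)

text \<open>Both sides are trilinear. The arguments are released from basis elements one at a time,
  starting with \<open>h\<close>; only the innermost step uses associativity of
  \<open>m\<close>.\<close>

lemma malg_mult_assoc:
  assumes f: "f \<in> carrier (malg M m e)" and g: "g \<in> carrier (malg M m e)"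
    and h: "h \<in> carrier (malg M m e)"
  shows "malg_mult m (malg_mult m f g) h = malg_mult m f (malg_mult m g h)"
proof -
  note malg_rules = malg_bilinear malg_mult_delta malg_finite delta_in malg_smult_in malg_mult_in malg_mult_zero
  have 1: "malg_mult m (malg_mult m (delta u) (delta v)) h = malg_mult m (delta u) (malg_mult m (delta v) h)"
    if "u \<in> M" "v \<in> M" for u v
    using h by (induction h rule: malg_induct) (use that in \<open>simp_all add: malg_rules m_in assoc\<close>)
  have 2: "malg_mult m (malg_mult m (delta u) g) h = malg_mult m (delta u) (malg_mult m g h)"
    if "u \<in> M" for u
    using g by (induction g rule: malg_induct) (use that h 1 in \<open>simp_all add: malg_rules m_in\<close>)
  show ?thesis
    using f by (induction f rule: malg_induct) (use g h 2 in \<open>simp_all add: malg_rules m_in\<close>)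
qed

lemma malg_one_left: "f \<in> carrier (malg M m e) \<Longrightarrow> malg_mult m (delta e) f = f"
  by (induction f rule: malg_induct)
    (simp_all add: malg_mult_zero malg_bilinear malg_finite delta_in malg_smult_in malg_mult_delta e_in e_left)

lemma malg_one_right: "f \<in> carrier (malg M m e) \<Longrightarrow> malg_mult m f (delta e) = f"
  by (induction f rule: malg_induct)
    (simp_all add: malg_mult_zero malg_bilinear malg_finite delta_in malg_smult_in malg_mult_delta e_in e_right)

lemma malg_kalg: "kalg (malg M m e :: ('k::field, 'm \<Rightarrow> 'k) module)"
proof -
  have neg: "\<exists>y\<in>carrier (malg M m e). (\<lambda>z. x z + y z) = (\<lambda>_. 0)"
    if "x \<in> carrier (malg M m e)" for x :: "'m \<Rightarrow> 'k"
    by (rule bexI[OF _ malg_smult_in[OF that, of "- 1"]]) simp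
  interpret ring "malg M m e :: ('k, 'm \<Rightarrow> 'k) module"
    by (intro ringI abelian_groupI monoidI; (unfold malg_ops)?)
      (simp_all add: malg_add_in malg_mult_in malg_mult_assoc malg_one_left malg_one_right
        malg_bilinear malg_finite delta_in e_in neg add_ac, simp add: malg_carrier_iff)
  show ?thesis
    by unfold_locales (unfold malg_ops,
        simp_all add: malg_smult_in malg_bilinear malg_finite algebra_simps)
qed

definition malg_lift :: "('k::field, 'b) module \<Rightarrow> ('m \<Rightarrow> 'b) \<Rightarrow> ('m \<Rightarrow> 'k) \<Rightarrow> 'b" where
  "malg_lift B \<phi> f = (\<Oplus>\<^bsub>B\<^esub>x\<in>{x. f x \<noteq> 0}. f x \<odot>\<^bsub>B\<^esub> \<phi> x)"

text \<open>Universal property of a monoid algebra: a multiplicative map into \<open>B\<close>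
  extends linearly to an algebra homomorphism.\<close>

lemma malg_lift:
  assumes "kalg B" and \<phi>: "\<And>x. x \<in> M \<Longrightarrow> \<phi> x \<in> carrier B"
    and \<phi>m: "\<And>x y. x \<in> M \<Longrightarrow> y \<in> M \<Longrightarrow> \<phi> (m x y) = \<phi> x \<otimes>\<^bsub>B\<^esub> \<phi> y"
    and \<phi>e: "\<phi> e = \<one>\<^bsub>B\<^esub>"
  shows malg_lift_hom: "alg_hom (malg M m e) B (malg_lift B \<phi>)"
    and malg_lift_delta: "\<And>x. x \<in> M \<Longrightarrow> malg_lift B \<phi> (delta x) = \<phi> x"
proof -
  interpret B: kalg B by fact
  let ?L = "malg_lift B \<phi>"
  \<comment> \<open>As with the product, the sum may run over any finite superset of the support,
    because the extra coefficients are 0.\<close>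
  have sup: "?L f = (\<Oplus>\<^bsub>B\<^esub>x\<in>U. f x \<odot>\<^bsub>B\<^esub> \<phi> x)"
    if "finite U" "{x. f x \<noteq> 0} \<subseteq> U" "U \<subseteq> M" for f U
    unfolding malg_lift_def using that \<phi>
    by (intro B.add.finprod_mono_neutral_cong_left) auto
  show delta: "?L (delta x) = \<phi> x" if "x \<in> M" for x
    using that \<phi> by (subst sup[of "{x}"]) (auto simp: delta_def)
  have closed: "?L f \<in> carrier B" if "f \<in> carrier (malg M m e)" for f
    unfolding malg_lift_def using that \<phi> by (intro B.finsum_closed) (auto simp: malg_carrier_iff)
  have add: "?L (\<lambda>x. f x + g x) = ?L f \<oplus>\<^bsub>B\<^esub> ?L g"
    if "f \<in> carrier (malg M m e)" "g \<in> carrier (malg M m e)" for f g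
  proof -
    let ?U = "{x. f x \<noteq> 0} \<union> {x. g x \<noteq> 0}"
    have U: "finite ?U" "?U \<subseteq> M"
      using that by (auto simp: malg_carrier_iff)
    have "?L (\<lambda>x. f x + g x) = (\<Oplus>\<^bsub>B\<^esub>x\<in>?U. f x \<odot>\<^bsub>B\<^esub> \<phi> x \<oplus>\<^bsub>B\<^esub> g x \<odot>\<^bsub>B\<^esub> \<phi> x)"
      using U \<phi> by (subst sup[OF U(1) _ U(2)]) (auto intro!: B.finsum_cong' simp: B.smult_l_distr)
    also have "\<dots> = ?L f \<oplus>\<^bsub>B\<^esub> ?L g"
      using U \<phi> by (subst (1 2) sup[OF U(1) _ U(2)]) (auto intro!: B.finsum_addf)
    finally show ?thesis .
  qed
  have smult: "?L (\<lambda>x. c * f x) = c \<odot>\<^bsub>B\<^esub> ?L f" if "f \<in> carrier (malg M m e)" for c f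
  proof -
    let ?U = "{x. f x \<noteq> 0}"
    have U: "finite ?U" "?U \<subseteq> M"
      using that by (auto simp: malg_carrier_iff)
    have "finite Y \<Longrightarrow> Y \<subseteq> M \<Longrightarrow> (\<Oplus>\<^bsub>B\<^esub>x\<in>Y. (c * f x) \<odot>\<^bsub>B\<^esub> \<phi> x) = c \<odot>\<^bsub>B\<^esub> (\<Oplus>\<^bsub>B\<^esub>x\<in>Y. f x \<odot>\<^bsub>B\<^esub> \<phi> x)" for Y
    proof (induction Y rule: finite_induct)
      case (insert y Y)
      then have "(\<lambda>x. f x \<odot>\<^bsub>B\<^esub> \<phi> x) \<in> Y \<rightarrow> carrier B" "(\<lambda>x. (c * f x) \<odot>\<^bsub>B\<^esub> \<phi> x) \<in> Y \<rightarrow> carrier B"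
        using \<phi> by auto
      with insert show ?case
        using \<phi> by (simp add: B.smult_r_distr B.smult_assoc B.finsum_closed)
    qed simp
    with U show ?thesis
      by (subst (1 2) sup[OF U(1) _ U(2)]) auto
  qed
  have zero: "?L (\<lambda>_. 0) = \<zero>\<^bsub>B\<^esub>"
    by (simp add: malg_lift_def)
  have mult_delta: "?L (malg_mult m (delta u) g) = \<phi> u \<otimes>\<^bsub>B\<^esub> ?L g"
    if "g \<in> carrier (malg M m e)" "u \<in> M" for u g
    using that
  proof (induction g rule: malg_induct)
    case zero
    then show ?case using \<phi> by (simp add: malg_mult_zero \<open>?L (\<lambda>_. 0) = \<zero>\<^bsub>B\<^esub>\<close>)
  next
    case (step g v c)
    then show ?case
      using \<phi> by (simp add: malg_bilinear malg_mult_delta malg_finite delta_in malg_smult_in malg_mult_in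
          add smult delta m_in \<phi>m closed B.r_distr B.smult_mult_right)
  qed
  have mult: "?L (malg_mult m f g) = ?L f \<otimes>\<^bsub>B\<^esub> ?L g"
    if "f \<in> carrier (malg M m e)" "g \<in> carrier (malg M m e)" for f g
    using that
  proof (induction f rule: malg_induct)
    case zero
    then show ?case by (simp add: malg_mult_zero \<open>?L (\<lambda>_. 0) = \<zero>\<^bsub>B\<^esub>\<close> closed)
  next
    case (step f u c)
    then show ?case
      using \<phi> by (simp add: malg_bilinear malg_finite delta_in malg_smult_in malg_mult_in
          add smult delta mult_delta closed B.l_distr B.smult_mult_left)
  qed
  show "alg_hom (malg M m e) B ?L"
    by (rule alg_homI; (unfold malg_ops)?) (simp_all add: closed mult add smult delta e_in \<phi>e)
qed

end

text \<open>Relations are written with pointwise subtraction, which is not an operation of the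
  record; it is read as adding the multiple by -1.\<close>

lemma (in set_monoid) malg_hom_diff:
  assumes B: "kalg B" and h: "alg_hom (malg M m e) B h"
    and fg: "f \<in> carrier (malg M m e)" "g \<in> carrier (malg M m e)"
  shows "h (\<lambda>x. f x - g x) = h f \<ominus>\<^bsub>B\<^esub> h g"
proof -
  interpret B: kalg B by fact
  have "h (\<lambda>x. f x + (- 1) * g x) = h f \<oplus>\<^bsub>B\<^esub> h (\<lambda>x. (- 1) * g x)"
    using alg_hom_add[OF h fg(1) malg_smult_in[OF fg(2), of "- 1"]] by (simp only: malg_ops)
  moreover have "h (\<lambda>x. (- 1) * g x) = (- 1) \<odot>\<^bsub>B\<^esub> h g"
    using alg_hom_smult[OF h fg(2), of "- 1"] by (simp only: malg_ops)
  ultimately show ?thesis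
    using alg_hom_closed[OF h fg(2)] by (simp add: B.smult_minus_left a_minus_def)
qed

text \<open>The algebra over \<open>{x \<in> M. P x}\<close> serves only through its carrier, the
  functions supported where \<open>P\<close> holds; the subset need not be a submonoid. In this form
  \<open>malg_induct\<close> applies to graded components.\<close>

lemma (in set_monoid) qcomp_eq:
  "qcomp (malg M m e) I P = (\<lambda>f. I +>\<^bsub>malg M m e\<^esub> f) ` carrier (malg {x \<in> M. P x} m e)"
  by (auto simp: qcomp_def malg_carrier_iff image_iff subset_iff)

lemma malg_carrier_mono: "M' \<subseteq> M \<Longrightarrow> f \<in> carrier (malg M' m e) \<Longrightarrow> f \<in> carrier (malg M m e)"
  by (auto simp: malg_carrier_iff)

text \<open>Linear subspaces are the targets in which images of graded components are located, and
  also the sets of elements with a given commutation property.\<close>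

definition subsp :: "('k, 'b) module \<Rightarrow> 'b set \<Rightarrow> bool" where
  "subsp B V \<longleftrightarrow> V \<subseteq> carrier B \<and> \<zero>\<^bsub>B\<^esub> \<in> V \<and> (\<forall>x\<in>V. \<forall>y\<in>V. x \<oplus>\<^bsub>B\<^esub> y \<in> V) \<and>
    (\<forall>c. \<forall>x\<in>V. c \<odot>\<^bsub>B\<^esub> x \<in> V)"

section \<open>Quotients of monoid algebras and the components spanned by basis classes\<close>

context set_monoid begin

context
  fixes I :: "('m \<Rightarrow> 'k::field) set"
  assumes I: "ideal I (malg M m e)"
begin

interpretation A: kalg "malg M m e :: ('k, 'm \<Rightarrow> 'k) module" by (rule malg_kalg)
interpretation Q: kalg "qalg (malg M m e) I" by (rule A.qalg_kalg[OF I])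

lemma qcomp_delta: "x \<in> M \<Longrightarrow> P x \<Longrightarrow> I +>\<^bsub>malg M m e\<^esub> delta x \<in> qcomp (malg M m e) I P"
  by (auto simp: qcomp_eq intro!: imageI delta_in)

lemma coset_malg_add:
  "f \<in> carrier (malg M m e) \<Longrightarrow> g \<in> carrier (malg M m e) \<Longrightarrow>
   I +>\<^bsub>malg M m e\<^esub> (\<lambda>x. f x + g x) = (I +>\<^bsub>malg M m e\<^esub> f) \<oplus>\<^bsub>qalg (malg M m e) I\<^esub> (I +>\<^bsub>malg M m e\<^esub> g)"
  using A.qalg_add[OF I, of f g] by (simp add: malg_ops)

lemma coset_malg_smult:
  "f \<in> carrier (malg M m e) \<Longrightarrow>
   I +>\<^bsub>malg M m e\<^esub> (\<lambda>x. c * f x) = c \<odot>\<^bsub>qalg (malg M m e) I\<^esub> (I +>\<^bsub>malg M m e\<^esub> f)"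
  using A.qalg_smult[OF I, of f c] by (simp add: malg_ops)

lemma coset_malg_delta:
  "x \<in> M \<Longrightarrow> y \<in> M \<Longrightarrow>
   (I +>\<^bsub>malg M m e\<^esub> delta x) \<otimes>\<^bsub>qalg (malg M m e) I\<^esub> (I +>\<^bsub>malg M m e\<^esub> delta y) = I +>\<^bsub>malg M m e\<^esub> delta (m x y)"
  using A.qalg_mult[OF I, of "delta x" "delta y"] by (simp add: malg_ops malg_mult_delta delta_in)

lemma coset_malg_one: "I +>\<^bsub>malg M m e\<^esub> delta e = \<one>\<^bsub>qalg (malg M m e) I\<^esub>"
  by (simp add: A.qalg_one malg_ops)

lemma coset_malg_zero: "I +>\<^bsub>malg M m e\<^esub> (\<lambda>_. 0) = \<zero>\<^bsub>qalg (malg M m e) I\<^esub>"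
  using A.coset_zero_iff[OF I A.zero_closed] ideal.axioms(1)[OF I]
  by (simp add: malg_ops additive_subgroup.zero_closed[of I "malg M m e", simplified malg_ops])

lemma coset_malg_in: "f \<in> carrier (malg M m e) \<Longrightarrow> I +>\<^bsub>malg M m e\<^esub> f \<in> carrier (qalg (malg M m e) I)"
  by (rule A.coset_in_qalg)

lemma qcomp_subsp: "subsp (qalg (malg M m e) I) (qcomp (malg M m e) I P)"
proof -
  let ?M = "{x \<in> M. P x}"
  have sub: "f \<in> carrier (malg M m e)" if "f \<in> carrier (malg ?M m e)" for f :: "'m \<Rightarrow> 'k"
    using that by (rule malg_carrier_mono[rotated]) auto
  have z: "(\<lambda>_. 0) \<in> carrier (malg ?M m e)"
    by (simp add: malg_carrier_iff)
  show ?thesis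
    unfolding subsp_def qcomp_eq
  proof (intro conjI ballI allI)
    show "(\<lambda>f. I +>\<^bsub>malg M m e\<^esub> f) ` carrier (malg ?M m e) \<subseteq> carrier (qalg (malg M m e) I)"
      using sub coset_malg_in by blast
    show "\<zero>\<^bsub>qalg (malg M m e) I\<^esub> \<in> (\<lambda>f. I +>\<^bsub>malg M m e\<^esub> f) ` carrier (malg ?M m e)"
      using imageI[OF z, of "\<lambda>f. I +>\<^bsub>malg M m e\<^esub> f"] by (simp only: coset_malg_zero)
  next
    fix x y
    assume "x \<in> (\<lambda>f. I +>\<^bsub>malg M m e\<^esub> f) ` carrier (malg ?M m e)"
      "y \<in> (\<lambda>f. I +>\<^bsub>malg M m e\<^esub> f) ` carrier (malg ?M m e)"
    then show "x \<oplus>\<^bsub>qalg (malg M m e) I\<^esub> y \<in> (\<lambda>f. I +>\<^bsub>malg M m e\<^esub> f) ` carrier (malg ?M m e)"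
      by (elim imageE, hypsubst, subst coset_malg_add[symmetric]) (blast intro: sub malg_add_in)+
  next
    fix c x
    assume "x \<in> (\<lambda>f. I +>\<^bsub>malg M m e\<^esub> f) ` carrier (malg ?M m e)"
    then show "c \<odot>\<^bsub>qalg (malg M m e) I\<^esub> x \<in> (\<lambda>f. I +>\<^bsub>malg M m e\<^esub> f) ` carrier (malg ?M m e)"
      by (elim imageE, hypsubst, subst coset_malg_smult[symmetric]) (blast intro: sub malg_smult_in)+
  qed
qed

text \<open>The component is spanned by the classes of the basis elements satisfying
  \<open>P\<close>, so a linear map carries it into a subspace as soon as it does so on these
  classes.\<close>

lemma qcomp_hom_image:
  assumes B: "kalg B" and h: "alg_hom (qalg (malg M m e) I) B h" and V: "subsp B V"
    and hV: "\<And>x. x \<in> M \<Longrightarrow> P x \<Longrightarrow> h (I +>\<^bsub>malg M m e\<^esub> delta x) \<in> V"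
    and y: "y \<in> qcomp (malg M m e) I P"
  shows "h y \<in> V"
proof -
  let ?M = "{x \<in> M. P x}"
  have sub: "f \<in> carrier (malg M m e)" if "f \<in> carrier (malg ?M m e)" for f :: "'m \<Rightarrow> 'k"
    using that by (rule malg_carrier_mono[rotated]) auto
  have "h (I +>\<^bsub>malg M m e\<^esub> f) \<in> V" if "f \<in> carrier (malg ?M m e)" for f
    using that
  proof (induction f rule: malg_induct)
    case zero
    then show ?case
      using V alg_hom_zero[OF Q.kalg_axioms B h] by (simp add: coset_malg_zero subsp_def)
  next
    case (step f u c)
    then show ?case
      using V hV
      by (simp add: sub coset_malg_add coset_malg_smult delta_in malg_smult_in coset_malg_in
          alg_hom_add[OF h] alg_hom_smult[OF h] subsp_def)
  qed
  then show ?thesis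
    using y by (auto simp: qcomp_eq)
qed

text \<open>The support of a product lies in the product of the supports. With degree conditions for
  the predicates, this is compatibility of a grading with multiplication.\<close>

lemma qcomp_mult:
  assumes "\<And>x y. x \<in> M \<Longrightarrow> y \<in> M \<Longrightarrow> P1 x \<Longrightarrow> P2 y \<Longrightarrow> P3 (m x y)"
    and "a \<in> qcomp (malg M m e) I P1" and "b \<in> qcomp (malg M m e) I P2"
  shows "a \<otimes>\<^bsub>qalg (malg M m e) I\<^esub> b \<in> qcomp (malg M m e) I P3"
proof -
  obtain f g where f: "f \<in> carrier (malg M m e)" "\<forall>x. f x \<noteq> 0 \<longrightarrow> P1 x" "a = I +>\<^bsub>malg M m e\<^esub> f"
    and g: "g \<in> carrier (malg M m e)" "\<forall>x. g x \<noteq> 0 \<longrightarrow> P2 x" "b = I +>\<^bsub>malg M m e\<^esub> g"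
    using assms(2,3) by (auto simp: qcomp_def)
  have "P3 z" if "malg_mult m f g z \<noteq> 0" for z
  proof (rule ccontr)
    assume "\<not> P3 z"
    have "malg_mult m f g z = 0"
      unfolding malg_mult_def
    proof (rule sum.neutral, clarify)
      fix x y assume "f x \<noteq> 0" "g y \<noteq> 0"
      then have "P3 (m x y)"
        using f(1,2) g(1,2) assms(1) by (auto simp: malg_carrier_iff subset_iff)
      with \<open>\<not> P3 z\<close> show "(if m x y = z then f x * g y else 0) = 0"
        by auto
    qed
    with that show False by simp
  qed
  then show ?thesis
    using f g A.qalg_mult[OF I, of f g] malg_mult_in[of f g]
    by (auto simp: qcomp_def malg_ops)
qed

lemma qalg_malg_hom_eqI:
  assumes B: "kalg B" and h: "alg_hom (qalg (malg M m e) I) B h" and h': "alg_hom (qalg (malg M m e) I) B h'"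
    and eq: "\<And>x. x \<in> M \<Longrightarrow> h (I +>\<^bsub>malg M m e\<^esub> delta x) = h' (I +>\<^bsub>malg M m e\<^esub> delta x)"
    and y: "y \<in> carrier (qalg (malg M m e) I)"
  shows "h y = h' y"
proof -
  have "h (I +>\<^bsub>malg M m e\<^esub> f) = h' (I +>\<^bsub>malg M m e\<^esub> f)" if "f \<in> carrier (malg M m e)" for f
    using that
  proof (induction f rule: malg_induct)
    case zero
    then show ?case
      using alg_hom_zero[OF Q.kalg_axioms B h] alg_hom_zero[OF Q.kalg_axioms B h']
      by (simp add: coset_malg_zero)
  next
    case (step f u c)
    then show ?case
      by (simp add: eq coset_malg_add coset_malg_smult delta_in malg_smult_in coset_malg_in
          alg_hom_add[OF h] alg_hom_smult[OF h] alg_hom_add[OF h'] alg_hom_smult[OF h'])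
  qed
  then show ?thesis
    using y by (auto elim!: A.qalg_carrierE)
qed

end

end

section \<open>The quantum Clifford algebra by its universal property\<close>

interpretation words: set_monoid "{w. set w \<subseteq> G}" "(@)" "[]" for G :: "gen set"
  by unfold_locales auto

lemma free_alg_kalg: "kalg (free_alg G)"
  unfolding free_alg_def by (rule words.malg_kalg)

lemma mono_in: "set w \<subseteq> G \<Longrightarrow> mono w \<in> carrier (free_alg G)"
  by (simp add: mono_def free_alg_def delta_in)

lemma gens_iff [simp]:
  "Psi a \<in> gens N \<longleftrightarrow> a \<in> {1..N}" "PsiS a \<in> gens N \<longleftrightarrow> a \<in> {1..N}"
  "Om a \<in> gens N \<longleftrightarrow> a \<in> {1..N}" "OmI a \<in> gens N \<longleftrightarrow> a \<in> {1..N}"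
  by (auto simp: gens_def)

text \<open>The families that \<open>Cl q N k\<close> classifies: elements of an arbitrary algebra
  \<open>B\<close> satisfying the defining relations. With \<open>N\<close> = 1 the same locale
  describes what happens at a single index.\<close>

locale cliff = kalg B for B :: "('k::field, 'b) module" (structure) +
  fixes N :: nat and q :: 'k and k :: nat and g :: "gen \<Rightarrow> 'b"
  assumes g_in: "x \<in> gens N \<Longrightarrow> g x \<in> carrier B"
    and om_om: "a \<in> {1..N} \<Longrightarrow> b \<in> {1..N} \<Longrightarrow> g (Om a) \<otimes> g (Om b) = g (Om b) \<otimes> g (Om a)"
    and om_omi: "a \<in> {1..N} \<Longrightarrow> g (Om a) \<otimes> g (OmI a) = \<one>"
    and omi_om: "a \<in> {1..N} \<Longrightarrow> g (OmI a) \<otimes> g (Om a) = \<one>"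
    and om_psi: "a \<in> {1..N} \<Longrightarrow> b \<in> {1..N} \<Longrightarrow>
      g (Om a) \<otimes> g (Psi b) = (if a = b then q else 1) \<odot> (g (Psi b) \<otimes> g (Om a))"
    and om_psiS: "a \<in> {1..N} \<Longrightarrow> b \<in> {1..N} \<Longrightarrow>
      g (Om a) \<otimes> g (PsiS b) = (if a = b then inverse q else 1) \<odot> (g (PsiS b) \<otimes> g (Om a))"
    and psi_psi: "a \<in> {1..N} \<Longrightarrow> b \<in> {1..N} \<Longrightarrow> g (Psi a) \<otimes> g (Psi b) \<oplus> g (Psi b) \<otimes> g (Psi a) = \<zero>"
    and psiS_psiS: "a \<in> {1..N} \<Longrightarrow> b \<in> {1..N} \<Longrightarrow> g (PsiS a) \<otimes> g (PsiS b) \<oplus> g (PsiS b) \<otimes> g (PsiS a) = \<zero>"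
    and psi_psiS_omi: "a \<in> {1..N} \<Longrightarrow>
      g (Psi a) \<otimes> g (PsiS a) \<oplus> q ^ k \<odot> (g (PsiS a) \<otimes> g (Psi a)) = g (OmI a) [^] k"
    and psi_psiS_om: "a \<in> {1..N} \<Longrightarrow>
      g (Psi a) \<otimes> g (PsiS a) \<oplus> inverse q ^ k \<odot> (g (PsiS a) \<otimes> g (Psi a)) = g (Om a) [^] k"
    and psi_psiS: "a \<in> {1..N} \<Longrightarrow> b \<in> {1..N} \<Longrightarrow> a \<noteq> b \<Longrightarrow> g (Psi a) \<otimes> g (PsiS b) \<oplus> g (PsiS b) \<otimes> g (Psi a) = \<zero>"

definition ev :: "('k, 'b) module \<Rightarrow> (gen \<Rightarrow> 'b) \<Rightarrow> gen list \<Rightarrow> 'b" where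
  "ev B g w = foldr (\<lambda>x y. g x \<otimes>\<^bsub>B\<^esub> y) w \<one>\<^bsub>B\<^esub>"

lemma ev_simps [simp]: "ev B g [] = \<one>\<^bsub>B\<^esub>" "ev B g (x # w) = g x \<otimes>\<^bsub>B\<^esub> ev B g w"
  by (simp_all add: ev_def)

context kalg begin

lemma ev_in: "(\<And>x. x \<in> set w \<Longrightarrow> g x \<in> carrier A) \<Longrightarrow> ev A g w \<in> carrier A"
  by (induction w) auto

lemma ev_append:
  "(\<And>x. x \<in> set u \<union> set w \<Longrightarrow> g x \<in> carrier A) \<Longrightarrow> ev A g (u @ w) = ev A g u \<otimes> ev A g w"
  by (induction u) (auto simp: m_assoc ev_in)

lemma ev_replicate: "g x \<in> carrier A \<Longrightarrow> ev A g (replicate i x) = g x [^] i"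
proof (induction i)
  case (Suc i)
  then show ?case
    using nat_pow_Suc2[of "g x" i] by simp
qed simp

lemma free_alg_hom_mono:
  assumes h: "alg_hom (free_alg G) A h" and "set w \<subseteq> G"
  shows "h (mono w) = ev A (\<lambda>x. h (mono [x])) w"
  using assms(2)
proof (induction w)
  case Nil
  have "\<one>\<^bsub>free_alg G\<^esub> = (mono [] :: _ \<Rightarrow> 'k)"
    by (simp add: free_alg_def malg_ops mono_def)
  with alg_hom_one[OF h] show ?case
    by (metis ev_simps(1))
next
  case (Cons x w)
  have "(mono (x # w) :: _ \<Rightarrow> 'k) = mono [x] \<otimes>\<^bsub>free_alg G\<^esub> mono w"
    by (simp add: free_alg_def malg_ops mono_def malg_mult_delta)
  with Cons alg_hom_mult[OF h, of "mono [x]" "mono w"] show ?case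
    by (simp add: mono_in)
qed

lemma free_alg_lift:
  assumes "\<And>x. x \<in> G \<Longrightarrow> g x \<in> carrier A"
  shows "\<exists>h. alg_hom (free_alg G) A h \<and> (\<forall>x\<in>G. h (mono [x]) = g x)"
proof (intro exI conjI ballI)
  have *: "\<And>w. w \<in> {w. set w \<subseteq> G} \<Longrightarrow> ev A g w \<in> carrier A"
    "\<And>v w. v \<in> {w. set w \<subseteq> G} \<Longrightarrow> w \<in> {w. set w \<subseteq> G} \<Longrightarrow> ev A g (v @ w) = ev A g v \<otimes> ev A g w"
    using assms by (auto intro!: ev_in ev_append)
  show "alg_hom (free_alg G) A (words.malg_lift A (ev A g))"
    unfolding free_alg_def by (rule words.malg_lift_hom[OF kalg_axioms]) (use * in auto)
  fix x assume "x \<in> G"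
  then have "words.malg_lift A (ev A g) (delta [x]) = ev A g [x]"
    by (intro words.malg_lift_delta[OF kalg_axioms, of G]) (use * in auto)
  then show "words.malg_lift A (ev A g) (mono [x]) = g x"
    using assms \<open>x \<in> G\<close> by (simp add: mono_def)
qed

text \<open>Dictionary between the relation set and the locale \<open>cliff\<close>. One direction
  shows that the classes of the generators satisfy the relations, the other that a family satisfying
  them descends to the quotient.\<close>

lemma cl_rels_killed_iff:
  fixes q :: 'k
  assumes h: "alg_hom (free_alg (gens N)) A h"
  shows "(\<forall>r\<in>cl_rels N q k. h r = \<zero>) \<longleftrightarrow> cliff A N q k (\<lambda>x. h (mono [x]))"
proof -
  let ?g = "\<lambda>x. h (mono [x])"
  have g_in: "?g x \<in> carrier A" if "x \<in> gens N" for x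
    using that by (intro alg_hom_closed[OF h] mono_in) simp
  have h_mono: "h (mono w) = ev A ?g w" if "set w \<subseteq> gens N" for w
    by (rule free_alg_hom_mono[OF h that])
  have h_add: "h (\<lambda>w. f w + f' w) = h f \<oplus> h f'"
    if "f \<in> carrier (free_alg (gens N))" "f' \<in> carrier (free_alg (gens N))" for f f'
    using alg_hom_add[OF h that] by (simp add: free_alg_def malg_ops)
  have h_smult: "h (\<lambda>w. c * f w) = c \<odot> h f" if "f \<in> carrier (free_alg (gens N))" for c f
    using alg_hom_smult[OF h that] by (simp add: free_alg_def malg_ops)
  have in_smult: "(\<lambda>w. c * f w) \<in> carrier (free_alg (gens N))" if "f \<in> carrier (free_alg (gens N))" for c f
    using that by (simp add: free_alg_def malg_smult_in)
  have in_add: "(\<lambda>w. f w + f' w) \<in> carrier (free_alg (gens N))"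
    if "f \<in> carrier (free_alg (gens N))" "f' \<in> carrier (free_alg (gens N))" for f f'
    using that by (simp add: free_alg_def malg_add_in)
  have h_diff: "h (\<lambda>w. f w - f' w) = h f \<ominus> h f'"
    if "f \<in> carrier (free_alg (gens N))" "f' \<in> carrier (free_alg (gens N))" for f f'
    by (rule words.malg_hom_diff[OF kalg_axioms h[unfolded free_alg_def] that[unfolded free_alg_def]])
  have h_mono2: "h (mono [x, y]) = ?g x \<otimes> ?g y" if "x \<in> gens N" "y \<in> gens N" for x y
    using h_mono[of "[x, y]"] that g_in by simp
  have h_mono0: "h (mono []) = \<one>"
    using h_mono[of "[]"] by simp
  have h_replicate: "h (mono (replicate i x)) = ?g x [^] i" if "x \<in> gens N" for x i
    using h_mono[of "replicate i x"] that ev_replicate[of ?g x i] g_in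
    by (simp add: set_replicate_conv_if)
  note rules = h_add h_smult h_diff in_smult in_add mono_in set_replicate_conv_if
    h_mono2 h_mono0 h_replicate g_in r_right_minus_eq nat_pow_closed
  have r1: "h (\<lambda>w. mono [Om a, Om b] w - mono [Om b, Om a] w) = \<zero> \<longleftrightarrow> ?g (Om a) \<otimes> ?g (Om b) = ?g (Om b) \<otimes> ?g (Om a)"
    if "a \<in> {1..N}" "b \<in> {1..N}" for a b
    using that by (simp add: rules)
  have r2: "h (\<lambda>w. mono [Om a, OmI a] w - mono [] w) = \<zero> \<longleftrightarrow> ?g (Om a) \<otimes> ?g (OmI a) = \<one>"
    "h (\<lambda>w. mono [OmI a, Om a] w - mono [] w) = \<zero> \<longleftrightarrow> ?g (OmI a) \<otimes> ?g (Om a) = \<one>"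
    if "a \<in> {1..N}" for a
    using that by (simp_all add: rules)
  have r3: "h (\<lambda>w. mono [Om a, Psi b] w - c * mono [Psi b, Om a] w) = \<zero> \<longleftrightarrow>
      ?g (Om a) \<otimes> ?g (Psi b) = c \<odot> (?g (Psi b) \<otimes> ?g (Om a))"
    "h (\<lambda>w. mono [Om a, PsiS b] w - c * mono [PsiS b, Om a] w) = \<zero> \<longleftrightarrow>
      ?g (Om a) \<otimes> ?g (PsiS b) = c \<odot> (?g (PsiS b) \<otimes> ?g (Om a))"
    if "a \<in> {1..N}" "b \<in> {1..N}" for a b c
    using that by (simp_all add: rules)
  have r4: "h (\<lambda>w. mono [Psi a, Psi b] w + mono [Psi b, Psi a] w) = \<zero> \<longleftrightarrow>
      ?g (Psi a) \<otimes> ?g (Psi b) \<oplus> ?g (Psi b) \<otimes> ?g (Psi a) = \<zero>"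
    "h (\<lambda>w. mono [PsiS a, PsiS b] w + mono [PsiS b, PsiS a] w) = \<zero> \<longleftrightarrow>
      ?g (PsiS a) \<otimes> ?g (PsiS b) \<oplus> ?g (PsiS b) \<otimes> ?g (PsiS a) = \<zero>"
    "h (\<lambda>w. mono [Psi a, PsiS b] w + mono [PsiS b, Psi a] w) = \<zero> \<longleftrightarrow>
      ?g (Psi a) \<otimes> ?g (PsiS b) \<oplus> ?g (PsiS b) \<otimes> ?g (Psi a) = \<zero>"
    if "a \<in> {1..N}" "b \<in> {1..N}" for a b
    using that by (simp_all add: rules)
  have r5: "h (\<lambda>w. mono [Psi a, PsiS a] w + c * mono [PsiS a, Psi a] w - mono (replicate k (OmI a)) w) = \<zero> \<longleftrightarrow>
      ?g (Psi a) \<otimes> ?g (PsiS a) \<oplus> c \<odot> (?g (PsiS a) \<otimes> ?g (Psi a)) = ?g (OmI a) [^] k"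
    "h (\<lambda>w. mono [Psi a, PsiS a] w + c * mono [PsiS a, Psi a] w - mono (replicate k (Om a)) w) = \<zero> \<longleftrightarrow>
      ?g (Psi a) \<otimes> ?g (PsiS a) \<oplus> c \<odot> (?g (PsiS a) \<otimes> ?g (Psi a)) = ?g (Om a) [^] k"
    if "a \<in> {1..N}" for a c
    using that by (simp_all add: rules)
  \<comment> \<open>Quantifying over a set comprehension becomes quantifying over its indices, so
    that each block of \<open>cl_rels\<close> meets the corresponding locale assumption through
    \<open>r1\<close> to \<open>r5\<close>.\<close>
  have c1: "(\<forall>r\<in>{F a |a. P a}. Q r) \<longleftrightarrow> (\<forall>a. P a \<longrightarrow> Q (F a))" for F P and Q :: "(gen list \<Rightarrow> 'k) \<Rightarrow> bool"
    by blast
  have c2: "(\<forall>r\<in>{F a b |a b. P a b}. Q r) \<longleftrightarrow> (\<forall>a b. P a b \<longrightarrow> Q (F a b))"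
    for F P and Q :: "(gen list \<Rightarrow> 'k) \<Rightarrow> bool"
    by blast
  show ?thesis
    unfolding cliff_def cliff_axioms_def cl_rels_def ball_Un c1 c2 conj_assoc imp_conjL
    using kalg_axioms g_in by (simp only: r1 r2 r3 r4 r5 simp_thms cong: imp_cong)
qed

end

lemma cl_rels_in: "cl_rels N q k \<subseteq> carrier (free_alg (gens N))"
  unfolding cl_rels_def free_alg_def mono_def
  by (auto intro!: malg_diff_in malg_add_in malg_smult_in delta_in simp: set_replicate_conv_if split: if_splits)

lemma cl_ideal_ideal: "ideal (cl_ideal N q k) (free_alg (gens N))"
proof -
  interpret kalg "free_alg (gens N)" by (rule free_alg_kalg)
  show ?thesis
    unfolding cl_ideal_def by (rule genideal_ideal[OF cl_rels_in])
qed

lemma Cl_kalg: "kalg (Cl q N k)"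
  unfolding Cl_def by (rule kalg.qalg_kalg[OF free_alg_kalg cl_ideal_ideal])

definition gcl :: "'k::field \<Rightarrow> nat \<Rightarrow> nat \<Rightarrow> gen \<Rightarrow> (gen list \<Rightarrow> 'k) set" where
  "gcl q N k x = cl_ideal N q k +>\<^bsub>free_alg (gens N)\<^esub> mono [x]"

lemma Cl_proj: "alg_hom (free_alg (gens N)) (Cl q N k) (\<lambda>f. cl_ideal N q k +>\<^bsub>free_alg (gens N)\<^esub> f)"
  unfolding Cl_def by (rule kalg.qalg_proj[OF free_alg_kalg cl_ideal_ideal])

lemma Cl_cliff: "cliff (Cl q N k) N q k (gcl q N k)"
proof -
  interpret F: kalg "free_alg (gens N) :: ('a, gen list \<Rightarrow> 'a) module" by (rule free_alg_kalg)
  have "cl_ideal N q k +>\<^bsub>free_alg (gens N)\<^esub> r = \<zero>\<^bsub>Cl q N k\<^esub>" if "r \<in> cl_rels N q k" for r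
  proof -
    have "r \<in> cl_ideal N q k"
      unfolding cl_ideal_def using F.genideal_self[OF cl_rels_in] that by blast
    then show ?thesis
      unfolding Cl_def using F.coset_zero_iff[OF cl_ideal_ideal] cl_rels_in that by blast
  qed
  then show ?thesis
    using kalg.cl_rels_killed_iff[OF Cl_kalg Cl_proj] unfolding gcl_def by blast
qed

text \<open>Extend freely to words, note that the relations die by
  \<open>cl_rels_killed_iff\<close>, and factor through the ideal they generate.\<close>

lemma Cl_universal:
  assumes "cliff B N q k g"
  shows "\<exists>h. alg_hom (Cl q N k) B h \<and> (\<forall>x\<in>gens N. h (gcl q N k x) = g x)"
proof -
  interpret B: cliff B N q k g by fact
  obtain h where h: "alg_hom (free_alg (gens N)) B h" "\<forall>x\<in>gens N. h (mono [x]) = g x"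
    using B.free_alg_lift[of "gens N" g] B.g_in by blast
  have "cliff B N q k (\<lambda>x. h (mono [x]))"
    using assms h(2) by (simp add: cliff_def cliff_axioms_def)
  then have "\<forall>r\<in>cl_rels N q k. h r = \<zero>\<^bsub>B\<^esub>"
    using B.cl_rels_killed_iff[OF h(1)] by blast
  then obtain h' where h': "alg_hom (Cl q N k) B h'"
    "\<forall>x\<in>carrier (free_alg (gens N)). h' (cl_ideal N q k +>\<^bsub>free_alg (gens N)\<^esub> x) = h x"
    using kalg.qalg_factor[OF free_alg_kalg B.kalg_axioms h(1) cl_rels_in, of q k]
    unfolding Cl_def cl_ideal_def by blast
  have "h' (gcl q N k x) = g x" if "x \<in> gens N" for x
    using h'(2) h(2) that by (simp add: gcl_def mono_in)
  with h'(1) show ?thesis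
    by blast
qed

lemma Cl_word:
  "set w \<subseteq> gens N \<Longrightarrow> cl_ideal N q k +>\<^bsub>free_alg (gens N)\<^esub> mono w = ev (Cl q N k) (gcl q N k) w"
  using kalg.free_alg_hom_mono[OF Cl_kalg Cl_proj, of w N q k] by (simp add: gcl_def[abs_def])

lemma alg_hom_ev:
  assumes "kalg A" "alg_hom A B h" "\<And>x. x \<in> set w \<Longrightarrow> g x \<in> carrier A"
  shows "h (ev A g w) = ev B (\<lambda>x. h (g x)) w"
  using assms(3)
proof (induction w)
  case (Cons x w)
  then show ?case
    using kalg.ev_in[OF assms(1), of w g] by (simp add: alg_hom_mult[OF assms(2)])
qed (simp add: alg_hom_one[OF assms(2)])

lemma ev_cong: "(\<And>x. x \<in> set w \<Longrightarrow> g x = g' x) \<Longrightarrow> ev B g w = ev B g' w"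
  by (induction w) auto

lemma gcl_in: "x \<in> gens N \<Longrightarrow> gcl q N k x \<in> carrier (Cl q N k)"
  by (rule cliff.g_in[OF Cl_cliff])

text \<open>Words in the generators span, and a homomorphism is determined on a word by its values
  on the letters.\<close>

lemma Cl_hom_eqI:
  assumes "kalg B" "alg_hom (Cl q N k) B h" "alg_hom (Cl q N k) B h'"
    and eq: "\<And>x. x \<in> gens N \<Longrightarrow> h (gcl q N k x) = h' (gcl q N k x)"
    and "y \<in> carrier (Cl q N k)"
  shows "h y = h' y"
proof (rule words.qalg_malg_hom_eqI[where G = "gens N" and I = "cl_ideal N q k", folded free_alg_def, OF cl_ideal_ideal assms(1)])
  fix w assume w: "w \<in> {w. set w \<subseteq> gens N}"
  then have in_Cl: "gcl q N k x \<in> carrier (Cl q N k)" if "x \<in> set w" for x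
    using that by (auto intro: gcl_in)
  have "h (ev (Cl q N k) (gcl q N k) w) = ev B (\<lambda>x. h (gcl q N k x)) w"
    by (rule alg_hom_ev[OF Cl_kalg assms(2) in_Cl])
  also have "\<dots> = ev B (\<lambda>x. h' (gcl q N k x)) w"
    using w eq by (intro ev_cong) auto
  also have "\<dots> = h' (ev (Cl q N k) (gcl q N k) w)"
    by (rule alg_hom_ev[OF Cl_kalg assms(3) in_Cl, symmetric])
  finally have "h (ev (Cl q N k) (gcl q N k) w) = h' (ev (Cl q N k) (gcl q N k) w)" .
  then show "h (cl_ideal N q k +>\<^bsub>free_alg (gens N)\<^esub> delta w) = h' (cl_ideal N q k +>\<^bsub>free_alg (gens N)\<^esub> delta w)"
    using w Cl_word[of w N q k] by (simp add: mono_def)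
qed (use assms in \<open>simp_all add: Cl_def\<close>)

section \<open>The grading of \<open>Cl q N k\<close>\<close>

lemma cl_comp_subsp: "subsp (Cl q N k) (cl_comp q N k d)"
  unfolding Cl_def cl_comp_def free_alg_def
  by (rule words.qcomp_subsp[OF cl_ideal_ideal[unfolded free_alg_def]])

lemma wdeg_append: "wdeg (u @ w) a = wdeg u a + wdeg w a"
  by (simp add: wdeg_def)

lemma cl_comp_mult:
  "x \<in> cl_comp q N k d \<Longrightarrow> y \<in> cl_comp q N k d' \<Longrightarrow> x \<otimes>\<^bsub>Cl q N k\<^esub> y \<in> cl_comp q N k (\<lambda>a. d a + d' a)"
  unfolding Cl_def cl_comp_def free_alg_def
  by (rule words.qcomp_mult[OF cl_ideal_ideal[unfolded free_alg_def]]) (auto simp: wdeg_append fun_eq_iff)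

lemma cl_comp_word: "set w \<subseteq> gens N \<Longrightarrow> ev (Cl q N k) (gcl q N k) w \<in> cl_comp q N k (wdeg w)"
  using words.qcomp_delta[OF cl_ideal_ideal[unfolded free_alg_def], of w N "\<lambda>u. wdeg u = wdeg w" q k] Cl_word[of w N q k]
  by (simp add: cl_comp_def free_alg_def mono_def)

lemma cl_comp_gen:
  assumes "x \<in> gens N"
  shows "gcl q N k x \<in> cl_comp q N k (wdeg [x])"
proof -
  interpret kalg "Cl q N k" by (rule Cl_kalg)
  show ?thesis
    using cl_comp_word[of "[x]" N q k] gcl_in[OF assms, of q k] assms by simp
qed

lemma cl_comp_one: "\<one>\<^bsub>Cl q N k\<^esub> \<in> cl_comp q N k (\<lambda>_. 0)"
  using cl_comp_word[of "[]" N q k] by (simp add: wdeg_def[abs_def])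

lemma cl_comp_hom_image:
  assumes "kalg B" "alg_hom (Cl q N k) B h" "subsp B V"
    and "\<And>w. set w \<subseteq> gens N \<Longrightarrow> wdeg w = d \<Longrightarrow> h (ev (Cl q N k) (gcl q N k) w) \<in> V"
    and "y \<in> cl_comp q N k d"
  shows "h y \<in> V"
  using words.qcomp_hom_image[OF cl_ideal_ideal[unfolded free_alg_def] assms(1) assms(2)[unfolded Cl_def free_alg_def] assms(3) _
      assms(5)[unfolded cl_comp_def free_alg_def]] assms(4) Cl_word[of _ N q k]
  by (auto simp: mono_def free_alg_def)

text \<open>The whole algebra is the component belonging to the predicate that is always true, so
  the spanning argument for components applies.\<close>

lemma Cl_hom_image:
  assumes "kalg B" "alg_hom (Cl q N k) B h" "subsp B V"
    and *: "\<And>w. set w \<subseteq> gens N \<Longrightarrow> h (ev (Cl q N k) (gcl q N k) w) \<in> V"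
    and y: "y \<in> carrier (Cl q N k)"
  shows "h y \<in> V"
proof (rule words.qcomp_hom_image[OF cl_ideal_ideal[unfolded free_alg_def] assms(1) assms(2)[unfolded Cl_def free_alg_def] assms(3),
      of "\<lambda>_. True"])
  show "y \<in> qcomp (malg {w. set w \<subseteq> gens N} (@) []) (cl_ideal N q k) (\<lambda>_. True)"
    using y by (auto simp: Cl_def qcomp_def free_alg_def elim!: kalg.qalg_carrierE[OF free_alg_kalg[unfolded free_alg_def]])
qed (use * Cl_word[of _ N q k] in \<open>auto simp: mono_def free_alg_def\<close>)

section \<open>Commutation up to a scalar\<close>

text \<open>One relation covers commutation, anticommutation and the q-commutation with omega, and
  its scalars multiply along products. All sign bookkeeping of the twist is done in these
  scalars.\<close>

definition (in kalg) qcom :: "'k \<Rightarrow> 'a \<Rightarrow> 'a \<Rightarrow> bool" where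
  "qcom c x y \<longleftrightarrow> x \<otimes> y = c \<odot> (y \<otimes> x)"

context kalg begin

lemma qcomD: "qcom c x y \<Longrightarrow> x \<otimes> y = c \<odot> (y \<otimes> x)"
  by (simp add: qcom_def)

lemma qcom_one_right: "x \<in> carrier A \<Longrightarrow> qcom 1 x \<one>"
  by (simp add: qcom_def)

lemma qcom_one_left: "x \<in> carrier A \<Longrightarrow> qcom 1 \<one> x"
  by (simp add: qcom_def)

lemma qcom_mult_right:
  assumes "qcom c x y" "qcom d x z" and [simp]: "x \<in> carrier A" "y \<in> carrier A" "z \<in> carrier A"
  shows "qcom (c * d) x (y \<otimes> z)"
proof -
  have "x \<otimes> (y \<otimes> z) = (c \<odot> (y \<otimes> x)) \<otimes> z"
    using assms(1) by (simp add: qcom_def m_assoc[symmetric])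
  also have "\<dots> = c \<odot> (y \<otimes> (x \<otimes> z))"
    by (simp add: smult_mult_left m_assoc)
  also have "\<dots> = (c * d) \<odot> (y \<otimes> z \<otimes> x)"
    using assms(2) by (simp add: qcom_def smult_mult_right smult_assoc m_assoc)
  finally show ?thesis
    by (simp add: qcom_def)
qed

lemma qcom_mult_left:
  assumes "qcom c x z" "qcom d y z" and [simp]: "x \<in> carrier A" "y \<in> carrier A" "z \<in> carrier A"
  shows "qcom (c * d) (x \<otimes> y) z"
proof -
  have "x \<otimes> y \<otimes> z = x \<otimes> (d \<odot> (z \<otimes> y))"
    using assms(2) by (simp add: qcom_def m_assoc)
  also have "\<dots> = d \<odot> (x \<otimes> z \<otimes> y)"
    by (simp add: smult_mult_right m_assoc)
  also have "\<dots> = (c * d) \<odot> (z \<otimes> (x \<otimes> y))"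
    using assms(1) by (simp add: qcom_def smult_mult_left smult_assoc m_assoc mult.commute)
  finally show ?thesis
    by (simp add: qcom_def)
qed

lemma qcom_sym:
  assumes "qcom c x y" "c * d = 1" "x \<in> carrier A" "y \<in> carrier A"
  shows "qcom d y x"
  using assms by (simp add: qcom_def smult_assoc mult.commute)

lemma qcom_one_sym: "qcom 1 x y \<Longrightarrow> x \<in> carrier A \<Longrightarrow> y \<in> carrier A \<Longrightarrow> qcom 1 y x"
  by (rule qcom_sym) simp_all

lemma qcom_diff_right:
  "qcom c x y \<Longrightarrow> qcom c x z \<Longrightarrow> x \<in> carrier A \<Longrightarrow> y \<in> carrier A \<Longrightarrow> z \<in> carrier A \<Longrightarrow> qcom c x (y \<ominus> z)"
  by (simp add: qcom_def a_minus_def r_distr l_distr smult_r_distr r_minus l_minus smult_minus_right)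

lemma qcom_add_left:
  "qcom c x z \<Longrightarrow> qcom c y z \<Longrightarrow> x \<in> carrier A \<Longrightarrow> y \<in> carrier A \<Longrightarrow> z \<in> carrier A \<Longrightarrow> qcom c (x \<oplus> y) z"
  by (simp add: qcom_def r_distr l_distr smult_r_distr)

lemma qcom_smult_right:
  "qcom c x y \<Longrightarrow> x \<in> carrier A \<Longrightarrow> y \<in> carrier A \<Longrightarrow> qcom c x (d \<odot> y)"
  by (simp add: qcom_def smult_mult_left smult_mult_right smult_assoc mult.commute)

lemma qcom_smult_left:
  "qcom c x y \<Longrightarrow> x \<in> carrier A \<Longrightarrow> y \<in> carrier A \<Longrightarrow> qcom c (d \<odot> x) y"
  by (simp add: qcom_def smult_mult_left smult_mult_right smult_assoc mult.commute)

lemma qcom_pow_right: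
  assumes "qcom 1 x y" "x \<in> carrier A" "y \<in> carrier A"
  shows "qcom 1 x (y [^] (i::nat))"
proof (induction i)
  case (Suc i)
  then show ?case
    using qcom_mult_right[OF Suc assms(1)] assms by simp
qed (use assms in \<open>simp add: qcom_one_right\<close>)

text \<open>Write x z as z (y x) z, move y past x at the cost of c, and cancel y z.\<close>

lemma qcom_inverse_left:
  assumes "qcom c y x" "c \<noteq> 0" and inv: "y \<otimes> z = \<one>" "z \<otimes> y = \<one>"
    and [simp]: "x \<in> carrier A" "y \<in> carrier A" "z \<in> carrier A"
  shows "qcom (inverse c) z x"
proof -
  have "x \<otimes> z = z \<otimes> (y \<otimes> x) \<otimes> z"
    by (simp add: m_assoc[symmetric] inv)
  also have "\<dots> = z \<otimes> (c \<odot> (x \<otimes> y)) \<otimes> z"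
    using assms(1) by (simp add: qcom_def)
  also have "\<dots> = c \<odot> (z \<otimes> x)"
    by (simp add: smult_mult_left smult_mult_right m_assoc inv)
  finally show ?thesis
    using assms(2) by (simp add: qcom_def smult_assoc)
qed

text \<open>Division by 2; with equal indices in the anticommutation relations it yields psi^2 = 0
  and its analogue for psi*.\<close>

lemma double_zero:
  assumes "(2::'k) \<noteq> 0" "x \<in> carrier A" "x \<oplus> x = \<zero>"
  shows "x = \<zero>"
proof -
  have "(2::'k) \<odot> x = \<zero>"
    using smult_l_distr[of x 1 1] assms by simp
  then have "inverse 2 \<odot> ((2::'k) \<odot> x) = \<zero>"
    by simp
  then show ?thesis
    using assms smult_assoc[of x "inverse 2" 2] by simp
qed

lemma qcom_minus_one_iff:
  assumes "x \<in> carrier A" "y \<in> carrier A"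
  shows "qcom (- 1) x y \<longleftrightarrow> x \<otimes> y \<oplus> y \<otimes> x = \<zero>"
proof -
  have "qcom (- 1) x y \<longleftrightarrow> x \<otimes> y = \<ominus> (y \<otimes> x)"
    using assms by (simp add: qcom_def smult_minus_left)
  then show ?thesis
    using assms minus_equality[of "x \<otimes> y" "y \<otimes> x"] l_neg[of "y \<otimes> x"] by auto
qed

end

section \<open>The parity element\<close>

text \<open>The formula takes an arbitrary family \<open>g\<close>, so that it can be compared for
  the generators, their twists and their images under homomorphisms.\<close>

definition par_idem :: "('k::field, 'b) module \<Rightarrow> nat \<Rightarrow> (gen \<Rightarrow> 'b) \<Rightarrow> nat \<Rightarrow> 'b" where
  "par_idem B k g a = g (Om a) [^]\<^bsub>B\<^esub> k \<otimes>\<^bsub>B\<^esub> (g (Psi a) \<otimes>\<^bsub>B\<^esub> g (PsiS a))"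

definition parity :: "('k::field, 'b) module \<Rightarrow> nat \<Rightarrow> (gen \<Rightarrow> 'b) \<Rightarrow> nat \<Rightarrow> 'b" where
  "parity B k g a = (2 \<odot>\<^bsub>B\<^esub> par_idem B k g a) \<ominus>\<^bsub>B\<^esub> \<one>\<^bsub>B\<^esub>"

text \<open>Index and parity of a generator are all that the relations between different indices
  depend on.\<close>

fun gidx :: "gen \<Rightarrow> nat" where
  "gidx (Psi a) = a" | "gidx (PsiS a) = a" | "gidx (Om a) = a" | "gidx (OmI a) = a"

fun godd :: "gen \<Rightarrow> bool" where
  "godd (Psi a) = True" | "godd (PsiS a) = True" | "godd (Om a) = False" | "godd (OmI a) = False"

lemma gens_gidx: "x \<in> gens N \<longleftrightarrow> gidx x \<in> {1..N}"
  by (cases x) auto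

lemma parity_hom:
  assumes "kalg A" "kalg B" "alg_hom A B h"
    and "g (Psi a) \<in> carrier A" "g (PsiS a) \<in> carrier A" "g (Om a) \<in> carrier A"
  shows "h (parity A k g a) = parity B k (\<lambda>x. h (g x)) a"
proof -
  interpret A: kalg A by fact
  show ?thesis
    using assms(4-) unfolding parity_def par_idem_def
    by (simp add: alg_hom_diff[OF assms(1-3)] alg_hom_smult[OF assms(3)] alg_hom_mult[OF assms(3)]
        alg_hom_pow[OF assms(1-3)] alg_hom_one[OF assms(3)])
qed

locale cliff2 = cliff B N q k g
  for B :: "('k::field, 'b) module" (structure) and N :: nat and q :: 'k and k :: nat and g :: "gen \<Rightarrow> 'b" +
  assumes two: "(2 :: 'k) \<noteq> 0" and q0: "q \<noteq> 0"
begin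

abbreviation "E \<equiv> par_idem B k g"
abbreviation "s \<equiv> parity B k g"

lemma gen_in [simp]:
  "a \<in> {1..N} \<Longrightarrow> g (Psi a) \<in> carrier B" "a \<in> {1..N} \<Longrightarrow> g (PsiS a) \<in> carrier B"
  "a \<in> {1..N} \<Longrightarrow> g (Om a) \<in> carrier B" "a \<in> {1..N} \<Longrightarrow> g (OmI a) \<in> carrier B"
  by (simp_all add: g_in)

lemma E_in [simp]: "a \<in> {1..N} \<Longrightarrow> E a \<in> carrier B"
  by (simp add: par_idem_def)

lemma s_in [simp]: "a \<in> {1..N} \<Longrightarrow> s a \<in> carrier B"
  by (simp add: parity_def)

lemma psi_sq: "a \<in> {1..N} \<Longrightarrow> g (Psi a) \<otimes> g (Psi a) = \<zero>"
  by (rule double_zero[OF two _ psi_psi]) simp_all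

lemma psiS_sq: "a \<in> {1..N} \<Longrightarrow> g (PsiS a) \<otimes> g (PsiS a) = \<zero>"
  by (rule double_zero[OF two _ psiS_psiS]) simp_all

lemma qcom_om_even: "a \<in> {1..N} \<Longrightarrow> qcom 1 (g (Om a)) (g (Psi a) \<otimes> g (PsiS a))"
  using qcom_mult_right[of q "g (Om a)" "g (Psi a)" "inverse q" "g (PsiS a)"] om_psi[of a a] om_psiS[of a a] q0
  by (simp add: qcom_def)

text \<open>omega commutes with psi psi*, as the factors q and 1/q cancel. The two forms expose psi
  on the left or psi* on the right, next to whatever E is multiplied with.\<close>

lemma E_alt:
  assumes "a \<in> {1..N}"
  shows "E a = g (Psi a) \<otimes> g (PsiS a) \<otimes> g (Om a) [^] k"
proof -
  have "qcom 1 (g (Psi a) \<otimes> g (PsiS a)) (g (Om a) [^] k)"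
    using qcom_one_sym[OF qcom_om_even[OF assms]] assms by (intro qcom_pow_right) simp_all
  then show ?thesis
    using assms by (simp add: par_idem_def qcom_def)
qed

lemma om_pow_omi_pow:
  assumes "a \<in> {1..N}"
  shows "g (Om a) [^] (i::nat) \<otimes> g (OmI a) [^] i = \<one>" "g (OmI a) [^] (i::nat) \<otimes> g (Om a) [^] i = \<one>"
proof -
  have [simp]: "g (Om a) \<in> carrier B" "g (OmI a) \<in> carrier B"
    using assms by simp_all
  have *: "x [^] i \<otimes> y [^] i = \<one>" if [simp]: "x \<in> carrier B" "y \<in> carrier B" and xy: "x \<otimes> y = \<one>" for x y
  proof (induction i)
    case (Suc i)
    have "x [^] Suc i \<otimes> y [^] Suc i = x [^] i \<otimes> (x \<otimes> y) \<otimes> y [^] i"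
      using nat_pow_Suc2[of y i] by (simp add: m_assoc)
    then show ?case
      using Suc xy by simp
  qed simp
  show "g (Om a) [^] (i::nat) \<otimes> g (OmI a) [^] i = \<one>" "g (OmI a) [^] (i::nat) \<otimes> g (Om a) [^] i = \<one>"
    using * om_omi[OF assms] omi_om[OF assms] by simp_all
qed

text \<open>Multiply psi psi* + q^k psi* psi = omega^(-k) by psi on the right, or by psi* on the
  left: the second summand dies since squares of odd generators vanish, and omega^k cancels
  omega^(-k). The two vanishing products contain such a square outright.\<close>

lemma E_psi:
  assumes a: "a \<in> {1..N}"
  shows "E a \<otimes> g (Psi a) = g (Psi a)" "g (Psi a) \<otimes> E a = \<zero>"
    "g (PsiS a) \<otimes> E a = g (PsiS a)" "E a \<otimes> g (PsiS a) = \<zero>"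
proof -
  note [simp] = gen_in[OF a]
  let ?p = "g (Psi a)" and ?t = "g (PsiS a)" and ?W = "g (Om a) [^] k" and ?V = "g (OmI a) [^] k"
  have rel: "?p \<otimes> ?t \<oplus> q ^ k \<odot> (?t \<otimes> ?p) = ?V"
    by (rule psi_psiS_omi[OF a])
  have "(?p \<otimes> ?t \<oplus> q ^ k \<odot> (?t \<otimes> ?p)) \<otimes> ?p = ?p \<otimes> ?t \<otimes> ?p"
    using psi_sq[OF a] by (simp add: l_distr smult_mult_left m_assoc)
  then have 1: "?p \<otimes> ?t \<otimes> ?p = ?V \<otimes> ?p"
    by (simp add: rel)
  have "?t \<otimes> (?p \<otimes> ?t \<oplus> q ^ k \<odot> (?t \<otimes> ?p)) = ?t \<otimes> (?p \<otimes> ?t)"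
    using psiS_sq[OF a] by (simp add: r_distr smult_mult_right m_assoc[symmetric])
  then have 2: "?t \<otimes> (?p \<otimes> ?t) = ?t \<otimes> ?V"
    by (simp add: rel)
  have "E a \<otimes> ?p = ?W \<otimes> (?p \<otimes> ?t \<otimes> ?p)"
    by (simp add: par_idem_def m_assoc)
  then show "E a \<otimes> ?p = ?p"
    using om_pow_omi_pow(1)[OF a, of k] by (simp add: 1 m_assoc[symmetric])
  have "?t \<otimes> E a = ?t \<otimes> (?p \<otimes> ?t) \<otimes> ?W"
    by (simp add: E_alt[OF a] m_assoc)
  then show "?t \<otimes> E a = ?t"
    using om_pow_omi_pow(2)[OF a, of k] by (simp add: 2 m_assoc)
  show "?p \<otimes> E a = \<zero>"
    using psi_sq[OF a] by (simp add: E_alt[OF a] m_assoc[symmetric])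
  show "E a \<otimes> ?t = \<zero>"
    using psiS_sq[OF a] by (simp add: par_idem_def m_assoc)
qed

text \<open>Expand the second factor by \<open>E_alt\<close>; E then meets psi on its left and is
  absorbed.\<close>

lemma E_idem:
  assumes a: "a \<in> {1..N}"
  shows "E a \<otimes> E a = E a"
proof -
  have "E a \<otimes> E a = E a \<otimes> g (Psi a) \<otimes> g (PsiS a) \<otimes> g (Om a) [^] k"
    using gen_in[OF a] E_in[OF a] E_alt[OF a] by (simp add: m_assoc)
  then show ?thesis
    using E_psi(1)[OF a] E_alt[OF a] by simp
qed

lemma smult_two: "x \<in> carrier B \<Longrightarrow> 2 \<odot> x = x \<oplus> x"
  using smult_l_distr[of x 1 1] by simp

lemma s_sq:
  assumes a: "a \<in> {1..N}"
  shows "s a \<otimes> s a = \<one>"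
proof -
  have [simp]: "E a \<in> carrier B"
    using a by simp
  \<comment> \<open>With X = 2E this is (X - 1)^2 = (X - 1) X - (X - 1). Since X^2 = 2X, the first
    term is X, and the difference is 1.\<close>
  have "s a \<otimes> s a = (E a \<oplus> E a \<ominus> \<one>) \<otimes> (E a \<oplus> E a) \<ominus> (E a \<oplus> E a \<ominus> \<one>)"
    by (simp add: parity_def smult_two a_minus_def r_distr r_minus)
  also have "(E a \<oplus> E a \<ominus> \<one>) \<otimes> (E a \<oplus> E a) = E a \<oplus> E a"
    using E_idem[OF a] by (simp add: a_minus_def l_distr r_distr l_minus a_assoc r_neg)
  also have "E a \<oplus> E a \<ominus> (E a \<oplus> E a \<ominus> \<one>) = \<one>"
    using r_neg2[of "E a \<oplus> E a" \<one>] minus_add[of "E a \<oplus> E a" "\<ominus> \<one>"] by (simp add: a_minus_def)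
  finally show ?thesis .
qed

text \<open>E acts on psi and psi* as 1 from one side and as 0 from the other, so 2E - 1 acts as 1
  and -1. The opposite signs on the two sides are the anticommutation.\<close>

lemma s_psi:
  assumes a: "a \<in> {1..N}"
  shows "s a \<otimes> g (Psi a) = g (Psi a)" "g (Psi a) \<otimes> s a = \<ominus> g (Psi a)"
    "g (PsiS a) \<otimes> s a = g (PsiS a)" "s a \<otimes> g (PsiS a) = \<ominus> g (PsiS a)"
proof -
  have *: "(E a \<oplus> E a \<ominus> \<one>) \<otimes> x = E a \<otimes> x \<oplus> E a \<otimes> x \<oplus> \<ominus> x"
    "x \<otimes> (E a \<oplus> E a \<ominus> \<one>) = x \<otimes> E a \<oplus> x \<otimes> E a \<oplus> \<ominus> x" if "x \<in> carrier B" for x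
    using that E_in[OF a] by (simp_all add: a_minus_def l_distr r_distr l_minus r_minus)
  show "s a \<otimes> g (Psi a) = g (Psi a)" "g (Psi a) \<otimes> s a = \<ominus> g (Psi a)"
    "g (PsiS a) \<otimes> s a = g (PsiS a)" "s a \<otimes> g (PsiS a) = \<ominus> g (PsiS a)"
    using a by (simp_all add: parity_def smult_two * E_psi a_assoc r_neg)
qed

end

section \<open>Ordered products\<close>

primrec lprod :: "('k, 'b) module \<Rightarrow> (nat \<Rightarrow> 'b) \<Rightarrow> nat \<Rightarrow> 'b" where
  "lprod B f 0 = \<one>\<^bsub>B\<^esub>"
| "lprod B f (Suc j) = lprod B f j \<otimes>\<^bsub>B\<^esub> f j"

lemma lprod_cong: "(\<And>i. i < j \<Longrightarrow> f i = f' i) \<Longrightarrow> lprod B f j = lprod B f' j"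
  by (induction j) auto

context kalg begin

lemma lprod_in: "(\<And>i. i < j \<Longrightarrow> f i \<in> carrier A) \<Longrightarrow> lprod A f j \<in> carrier A"
  by (induction j) auto

lemma lprod_one: "lprod A (\<lambda>_. \<one>) j = \<one>"
  by (induction j) auto

lemma lprod_qcom_left:
  assumes "\<And>i. i < j \<Longrightarrow> qcom 1 (f i) z" "\<And>i. i < j \<Longrightarrow> f i \<in> carrier A" "z \<in> carrier A"
  shows "qcom 1 (lprod A f j) z"
  using assms
proof (induction j)
  case (Suc j)
  then have "qcom (1 * 1) (lprod A f j \<otimes> f j) z"
    by (intro qcom_mult_left lprod_in) auto
  then show ?case
    by simp
qed (simp add: qcom_one_left)

text \<open>Interleaved factors are sorted by moving each \<open>f' i\<close> to the right past the
  later \<open>f l\<close>, so commutation is required for i < l only.\<close>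

lemma lprod_mult:
  assumes "\<And>i. i < j \<Longrightarrow> f i \<in> carrier A" "\<And>i. i < j \<Longrightarrow> f' i \<in> carrier A"
    and "\<And>i l. i < l \<Longrightarrow> l < j \<Longrightarrow> qcom 1 (f' i) (f l)"
  shows "lprod A (\<lambda>i. f i \<otimes> f' i) j = lprod A f j \<otimes> lprod A f' j"
  using assms
proof (induction j)
  case (Suc j)
  have [simp]: "lprod A f j \<in> carrier A" "lprod A f' j \<in> carrier A" "f j \<in> carrier A" "f' j \<in> carrier A"
    using Suc.prems by (auto intro!: lprod_in)
  have "qcom 1 (lprod A f' j) (f j)"
    using Suc.prems by (intro lprod_qcom_left) auto
  then have c: "lprod A f' j \<otimes> f j = f j \<otimes> lprod A f' j"
    by (simp add: qcom_def)
  have "lprod A (\<lambda>i. f i \<otimes> f' i) (Suc j) = lprod A f j \<otimes> (lprod A f' j \<otimes> f j) \<otimes> f' j"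
    using Suc by (simp add: m_assoc)
  then show ?case
    unfolding c by (simp add: m_assoc)
qed simp

lemma lprod_add:
  assumes "\<And>i. i < j \<Longrightarrow> f i \<in> carrier A" "l < j" "x \<in> carrier A" "y \<in> carrier A"
  shows "lprod A (f(l := x \<oplus> y)) j = lprod A (f(l := x)) j \<oplus> lprod A (f(l := y)) j"
  using assms
proof (induction j)
  case (Suc j)
  have in_A: "lprod A (f(l := z)) j \<in> carrier A" if "z \<in> carrier A" for z
    using Suc.prems that by (intro lprod_in) auto
  show ?case
  proof (cases "l = j")
    case True
    then have "lprod A (f(l := z)) j = lprod A f j" for z
      by (intro lprod_cong) auto
    then show ?thesis
      using True Suc.prems lprod_in[of j f] by (simp add: r_distr fun_upd_same del: fun_upd_apply)
  next
    case False
    then show ?thesis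
      using Suc in_A by (simp add: l_distr fun_upd_other del: fun_upd_apply)
  qed
qed simp

lemma lprod_smult:
  assumes "\<And>i. i < j \<Longrightarrow> f i \<in> carrier A" "l < j" "x \<in> carrier A"
  shows "lprod A (f(l := c \<odot> x)) j = c \<odot> lprod A (f(l := x)) j"
  using assms
proof (induction j)
  case (Suc j)
  have in_A: "lprod A (f(l := z)) j \<in> carrier A" if "z \<in> carrier A" for z
    using Suc.prems that by (intro lprod_in) auto
  show ?case
  proof (cases "l = j")
    case True
    then have "lprod A (f(l := z)) j = lprod A f j" for z
      by (intro lprod_cong) auto
    then show ?thesis
      using True Suc.prems lprod_in[of j f] by (simp add: smult_mult_right fun_upd_same del: fun_upd_apply)
  next
    case False
    then show ?thesis
      using Suc in_A by (simp add: smult_mult_left fun_upd_other del: fun_upd_apply)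
  qed
qed simp

end

lemma alg_hom_lprod:
  assumes "kalg A" "alg_hom A B h" "\<And>i. i < j \<Longrightarrow> f i \<in> carrier A"
  shows "h (lprod A f j) = lprod B (\<lambda>i. h (f i)) j"
  using assms(3)
proof (induction j)
  case (Suc j)
  then show ?case
    using kalg.lprod_in[OF assms(1), of j f] by (simp add: alg_hom_mult[OF assms(2)])
qed (simp add: alg_hom_one[OF assms(2)])

fun gsh :: "nat \<Rightarrow> gen \<Rightarrow> gen" where
  "gsh b (Psi a) = Psi b" | "gsh b (PsiS a) = PsiS b" | "gsh b (Om a) = Om b" | "gsh b (OmI a) = OmI b"

lemma gsh_simps [simp]: "gidx (gsh b x) = b" "godd (gsh b x) = godd x"
  by (cases x; simp)+

section \<open>Commutation rules between generators and parity elements\<close>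

context cliff2 begin

lemma qcom_om_gen:
  assumes a: "a \<in> {1..N}" and y: "y \<in> gens N" "gidx y \<noteq> a \<or> \<not> godd y"
  shows "qcom 1 (g (Om a)) (g y)"
proof (cases y)
  case (OmI b)
  show ?thesis
  proof (cases "a = b")
    case True
    then show ?thesis
      using a om_omi[OF a] omi_om[OF a] by (simp add: qcom_def OmI)
  next
    case False
    have b: "b \<in> {1..N}"
      using y by (simp add: OmI)
    have "qcom 1 (g (Om b)) (g (Om a))"
      using om_om[OF b a] a b by (simp add: qcom_def)
    then have "qcom (inverse 1) (g (OmI b)) (g (Om a))"
      by (rule qcom_inverse_left) (use a b om_omi[OF b] omi_om[OF b] in simp_all)
    then show ?thesis
      using a b qcom_one_sym[of "g (OmI b)" "g (Om a)"] by (simp add: OmI)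
  qed
next
  case (Om b)
  then show ?thesis
    using a y om_om[of a b] by (simp add: qcom_def)
next
  case (Psi b)
  then show ?thesis
    using a y om_psi[of a b] by (simp add: qcom_def)
next
  case (PsiS b)
  then show ?thesis
    using a y om_psiS[of a b] by (simp add: qcom_def)
qed

lemma qcom_omi_gen:
  assumes "a \<in> {1..N}" "y \<in> gens N" "gidx y \<noteq> a \<or> \<not> godd y"
  shows "qcom 1 (g (OmI a)) (g y)"
proof -
  have "qcom (inverse 1) (g (OmI a)) (g y)"
    by (rule qcom_inverse_left[OF qcom_om_gen[OF assms]]) (use assms om_omi omi_om g_in in simp_all)
  then show ?thesis
    by simp
qed

text \<open>All defining relations between different indices condense into the super sign rule, a
  form in which the twist can act on them.\<close>

lemma qcom_gens:
  assumes "x \<in> gens N" "y \<in> gens N" "gidx x \<noteq> gidx y"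
  shows "qcom (if godd x \<and> godd y then - 1 else 1) (g x) (g y)"
proof -
  have even: "qcom 1 (g x) (g y)" if "\<not> godd x" "x \<in> gens N" "y \<in> gens N" "gidx x \<noteq> gidx y" for x y
    using that qcom_om_gen[of "gidx x" y] qcom_omi_gen[of "gidx x" y] by (cases x) (auto simp: gens_gidx)
  consider "\<not> godd x" | "\<not> godd y" | "godd x" "godd y"
    by blast
  then show ?thesis
  proof cases
    case 1
    then show ?thesis using even assms by simp
  next
    case 2
    then have "qcom 1 (g x) (g y)"
      using qcom_one_sym[OF even[of y x]] assms g_in by simp
    with 2 show ?thesis by simp
  next
    case 3
    have "qcom (- 1) (g x) (g y)"
      using 3 assms psi_psi psiS_psiS psi_psiS
      by (cases x; cases y) (auto simp: qcom_minus_one_iff a_comm)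
    with 3 show ?thesis by simp
  qed
qed

text \<open>In s the generators psi and psi* occur only as a pair, so their scalars enter through
  the product c d. It equals 1 in all three applications: omega of the same index gives q and 1/q, a
  generator of another index gives the same sign twice, another parity element gives 1 and
  1.\<close>

lemma qcom_s:
  assumes "qcom c y (g (Psi a))" "qcom d y (g (PsiS a))" "c * d = 1" "qcom 1 y (g (Om a))"
    and [simp]: "y \<in> carrier B" and a: "a \<in> {1..N}"
  shows "qcom 1 y (s a)"
proof -
  note [simp] = gen_in[OF a]
  have "qcom (1 * (c * d)) y (E a)"
    unfolding par_idem_def using assms(1,2,4) by (intro qcom_mult_right qcom_pow_right) simp_all
  then have "qcom 1 y (E a)"
    using assms(3) by simp
  then show ?thesis
    unfolding parity_def using E_in[OF a] by (intro qcom_diff_right qcom_smult_right qcom_one_right) simp_all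
qed

text \<open>Conjugation by s_a is thus the parity automorphism at index a alone: it negates psi_a
  and psi_a* and fixes every other generator.\<close>

lemma s_gen:
  assumes a: "a \<in> {1..N}" and x: "x \<in> gens N"
  shows "qcom (if godd x \<and> gidx x = a then - 1 else 1) (s a) (g x)"
proof -
  have [simp]: "g x \<in> carrier B" "s a \<in> carrier B"
    using a x g_in by auto
  have om: "qcom 1 (g (Om a)) (s a)"
    by (rule qcom_s[of q _ _ "inverse q"]) (use a q0 om_psi om_psiS in \<open>simp_all add: qcom_def\<close>)
  consider "gidx x \<noteq> a" | "x = Psi a" | "x = PsiS a" | "x = Om a" | "x = OmI a"
    by (cases x) auto
  then show ?thesis
  proof cases
    case 1
    have "qcom 1 (g x) (s a)"
      using 1 a x qcom_gens[of x "Psi a"] qcom_gens[of x "PsiS a"] qcom_gens[of x "Om a"]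
      by (intro qcom_s[where c = "if godd x then - 1 else 1" and d = "if godd x then - 1 else 1"]) auto
    then show ?thesis
      using 1 qcom_one_sym[of "g x" "s a"] by simp
  next
    case 2
    then show ?thesis
      using a by (simp add: qcom_def s_psi smult_minus_left smult_minus_right)
  next
    case 3
    then show ?thesis
      using a by (simp add: qcom_def s_psi smult_minus_left)
  next
    case 4
    then show ?thesis
      using qcom_one_sym[OF om] a by simp
  next
    case 5
    have "qcom (inverse 1) (g (OmI a)) (s a)"
      by (rule qcom_inverse_left[OF om]) (use a om_omi omi_om in simp_all)
    then show ?thesis
      using 5 a qcom_one_sym[of "g (OmI a)" "s a"] by simp
  qed
qed

lemma s_comm:
  assumes "a \<in> {1..N}" "b \<in> {1..N}"
  shows "qcom 1 (s a) (s b)"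
proof (cases "a = b")
  case True
  then show ?thesis using assms by (simp add: qcom_def)
next
  case False
  then show ?thesis
    using assms s_gen[of a "Psi b"] s_gen[of a "PsiS b"] s_gen[of a "Om b"]
    by (intro qcom_s[where c = 1 and d = 1]) auto
qed

text \<open>Each relation is specialised to both indices equal to \<open>a\<close>; the relation
  requiring distinct indices is vacuous when only one index exists.\<close>

lemma restrict_cliff:
  assumes "a \<in> {1..N}"
  shows "cliff B 1 q k (\<lambda>x. g (gsh a x))"
proof (unfold_locales, goal_cases)
  case (1 x)
  then show ?case using assms g_in[of "gsh a x"] by (simp add: gens_gidx)
qed (use assms om_omi[of a] omi_om[of a] om_psi[of a a] om_psiS[of a a] psi_psi[of a a] psiS_psiS[of a a]
    psi_psiS_om[of a] psi_psiS_omi[of a] in simp_all)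

end

section \<open>The Jordan--Wigner twist\<close>

text \<open>The sign \<epsilon> is the one between odd generators of different indices: -1 in the
  Clifford algebra, 1 in the tensor power. Keeping it a parameter lets one argument serve both
  directions, the twist turning \<epsilon> into -\<epsilon>.\<close>

locale twist = kalg B for B :: "('k::field, 'b) module" (structure) +
  fixes N :: nat and e :: "gen \<Rightarrow> 'b" and s :: "nat \<Rightarrow> 'b" and \<epsilon> :: 'k
  assumes e_in: "x \<in> gens N \<Longrightarrow> e x \<in> carrier B"
    and s_in: "a \<in> {1..N} \<Longrightarrow> s a \<in> carrier B"
    and s_sq: "a \<in> {1..N} \<Longrightarrow> s a \<otimes> s a = \<one>"
    and s_comm: "a \<in> {1..N} \<Longrightarrow> b \<in> {1..N} \<Longrightarrow> qcom 1 (s a) (s b)"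
    and s_e: "a \<in> {1..N} \<Longrightarrow> x \<in> gens N \<Longrightarrow> qcom (if godd x \<and> gidx x = a then - 1 else 1) (s a) (e x)"
    and e_cross: "x \<in> gens N \<Longrightarrow> y \<in> gens N \<Longrightarrow> gidx x \<noteq> gidx y \<Longrightarrow>
      qcom (if godd x \<and> godd y then \<epsilon> else 1) (e x) (e y)"
    and eps: "\<epsilon> * \<epsilon> = 1"
begin

text \<open>The Jordan-Wigner string s_1 ... s_j; the shift by \<open>Suc\<close> appears because
  \<open>lprod\<close> counts from 0 and generators from 1.\<close>

abbreviation "S \<equiv> lprod B (\<lambda>i. s (Suc i))"

lemma S_in [simp]: "j \<le> N \<Longrightarrow> S j \<in> carrier B"
  by (rule lprod_in) (simp add: s_in)

lemma S_sq:
  assumes "j \<le> N"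
  shows "S j \<otimes> S j = \<one>"
proof -
  have "lprod B (\<lambda>i. s (Suc i) \<otimes> s (Suc i)) j = S j \<otimes> S j"
    using assms s_comm s_in by (intro lprod_mult) auto
  moreover have "lprod B (\<lambda>i. s (Suc i) \<otimes> s (Suc i)) j = lprod B (\<lambda>_. \<one>) j"
    using assms s_sq by (intro lprod_cong) auto
  ultimately show ?thesis
    by (simp add: lprod_one)
qed

lemma S_comm:
  assumes "j \<le> N" "l \<le> N"
  shows "qcom 1 (S j) (S l)"
proof (rule lprod_qcom_left)
  fix i assume "i < j"
  then have "qcom 1 (S l) (s (Suc i))"
    using assms s_comm s_in by (intro lprod_qcom_left) auto
  then show "qcom 1 (s (Suc i)) (S l)"
    by (rule qcom_one_sym) (use assms \<open>i < j\<close> s_in in simp_all)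
qed (use assms s_in in auto)

text \<open>Only the factor s_i with i = \<open>gidx x\<close> can contribute a sign, so the sign
  tells whether the string reaches that index.\<close>

lemma S_e:
  assumes "j \<le> N" "x \<in> gens N"
  shows "qcom (if godd x \<and> gidx x \<le> j then - 1 else 1) (S j) (e x)"
  using assms(1)
proof (induction j)
  case 0
  then show ?case
    using assms(2) e_in by (auto simp: gens_gidx qcom_one_left)
next
  case (Suc j)
  have "qcom ((if godd x \<and> gidx x \<le> j then - 1 else 1) * (if godd x \<and> gidx x = Suc j then - 1 else 1))
      (S j \<otimes> s (Suc j)) (e x)"
    using Suc assms(2) e_in s_in by (intro qcom_mult_left s_e) auto
  moreover have "(if godd x \<and> gidx x \<le> j then - 1 else 1) * (if godd x \<and> gidx x = Suc j then - 1 else 1)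
      = (if godd x \<and> gidx x \<le> Suc j then - 1 else 1 :: 'k)"
    by auto
  ultimately show ?case
    by simp
qed

text \<open>The string ends at \<open>gidx x - 1\<close>, just below the index of the generator, and
  therefore commutes with the generator it multiplies.\<close>

definition tw :: "gen \<Rightarrow> 'b" where
  "tw x = (if godd x then S (gidx x - 1) \<otimes> e x else e x)"

lemma tw_in: "x \<in> gens N \<Longrightarrow> tw x \<in> carrier B"
  using e_in[of x] by (auto simp: tw_def gens_gidx)

lemma S_tw: "x \<in> gens N \<Longrightarrow> godd x \<Longrightarrow> S (gidx x - 1) \<otimes> tw x = e x"
  using e_in[of x] S_sq[of "gidx x - 1"] by (auto simp: tw_def gens_gidx m_assoc[symmetric])

text \<open>The inner copy of the string moves past \<open>e x\<close> without a sign and cancels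
  the outer copy. Hence no quadratic expression in odd generators of one index notices the
  twist.\<close>

lemma tw_mult:
  assumes "x \<in> gens N" "y \<in> gens N" "godd x" "godd y" "gidx x = gidx y"
  shows "tw x \<otimes> tw y = e x \<otimes> e y"
proof -
  note One_nat_def [simp del]
  let ?S = "S (gidx y - 1)"
  have y: "gidx y \<in> {1..N}"
    using assms(2) by (simp add: gens_gidx)
  then have [simp]: "?S \<in> carrier B" "e x \<in> carrier B" "e y \<in> carrier B"
    using assms e_in by auto
  have "?S \<otimes> e x = e x \<otimes> ?S"
  proof -
    have "gidx y - 1 \<le> N" "\<not> gidx x \<le> gidx y - 1"
      using y assms(5) by auto
    then show ?thesis
      using S_e[OF _ assms(1), of "gidx y - 1"] by (simp add: qcom_def)
  qed
  then have "tw x \<otimes> tw y = e x \<otimes> (?S \<otimes> ?S) \<otimes> e y"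
    using assms by (simp add: tw_def m_assoc)
  then show ?thesis
    using S_sq[of "gidx y - 1"] y by (simp add: le_diff_conv)
qed

text \<open>Relations in products of two odd generators are untouched by \<open>tw_mult\<close>.
  There remain those moving omega past an odd generator, which survive because omega commutes with
  the string.\<close>

lemma tw_cliff:
  assumes a: "a \<in> {1..N}" and "cliff B 1 q k (\<lambda>x. e (gsh a x))"
  shows "cliff B 1 q k (\<lambda>x. tw (gsh a x))"
proof -
  interpret e: cliff B 1 q k "\<lambda>x. e (gsh a x)" by fact
  note One_nat_def [simp del]
  have in_B [simp]: "S (a - 1) \<in> carrier B" "e (Psi a) \<in> carrier B" "e (PsiS a) \<in> carrier B"
    "e (Om a) \<in> carrier B" "e (OmI a) \<in> carrier B"
    using a e_in by auto
  have "qcom 1 (S (a - 1)) (e (Om a))"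
    using S_e[of "a - 1" "Om a"] a by (simp add: le_diff_conv)
  then have omS: "qcom 1 (e (Om a)) (S (a - 1))"
    by (rule qcom_one_sym) simp_all
  have om1: "qcom (1 * q) (e (Om a)) (S (a - 1) \<otimes> e (Psi a))"
    by (rule qcom_mult_right[OF omS]) (use e.om_psi[of 1 1] in \<open>simp_all add: qcom_def\<close>)
  have om2: "qcom (1 * inverse q) (e (Om a)) (S (a - 1) \<otimes> e (PsiS a))"
    by (rule qcom_mult_right[OF omS]) (use e.om_psiS[of 1 1] in \<open>simp_all add: qcom_def\<close>)
  have tw_om: "e (Om a) \<otimes> tw (Psi a) = q \<odot> (tw (Psi a) \<otimes> e (Om a))"
    "e (Om a) \<otimes> tw (PsiS a) = inverse q \<odot> (tw (PsiS a) \<otimes> e (Om a))"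
    using om1 om2 by (simp_all add: qcom_def tw_def)
  have mult: "tw x \<otimes> tw y = e x \<otimes> e y"
    if "x \<in> {Psi a, PsiS a}" "y \<in> {Psi a, PsiS a}" for x y
    using that a by (intro tw_mult) auto
  have even: "tw (Om a) = e (Om a)" "tw (OmI a) = e (OmI a)"
    by (simp_all add: tw_def)
  show ?thesis
  proof (unfold_locales, goal_cases)
    case (1 x)
    then show ?case using tw_in[of "gsh a x"] a by (simp add: gens_gidx)
  qed (use tw_om e.om_omi[of 1] e.omi_om[of 1] e.psi_psi[of 1 1] e.psiS_psiS[of 1 1]
      e.psi_psiS_om[of 1] e.psi_psiS_omi[of 1] in \<open>simp_all add: mult even\<close>)
qed

text \<open>The reason that the twist inverts itself: the strings needed to undo it can be formed
  from the twisted generators and are the same elements.\<close>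

lemma tw_parity:
  assumes "a \<in> {1..N}"
  shows "parity B k tw a = parity B k e a"
  using tw_mult[of "Psi a" "PsiS a"] assms by (simp add: parity_def par_idem_def tw_def[of "Om a"])

text \<open>Let x have the smaller index. The string of y contains s at the index of x and gives one
  extra sign against an odd \<open>e x\<close>; the shorter string of x commutes with
  \<open>e y\<close> and with the other string. So exactly one sign is added.\<close>

lemma tw_cross:
  assumes "x \<in> gens N" "y \<in> gens N" "gidx x \<noteq> gidx y"
  shows "qcom (if godd x \<and> godd y then - \<epsilon> else 1) (tw x) (tw y)"
proof -
  have less: "qcom (if godd x \<and> godd y then - \<epsilon> else 1) (tw x) (tw y)"
    if gens: "x \<in> gens N" "y \<in> gens N" and "gidx x < gidx y" for x y
  proof -
    note One_nat_def [simp del]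
    let ?j = "gidx x - 1" and ?l = "gidx y - 1"
    have jl: "?j \<le> N" "?l \<le> N" "gidx x \<le> ?l" "\<not> gidx y \<le> ?j"
      using that by (auto simp: gens_gidx)
    have [simp]: "S ?j \<in> carrier B" "S ?l \<in> carrier B" "e x \<in> carrier B" "e y \<in> carrier B"
      using jl gens e_in by simp_all
    have xy: "qcom (if godd x \<and> godd y then \<epsilon> else 1) (e x) (e y)"
      using e_cross[OF gens] that by simp
    have "qcom (if godd x then - 1 else 1) (S ?l) (e x)"
      using S_e[OF jl(2) gens(1)] jl by simp
    then have xS: "qcom (if godd x then - 1 else 1) (e x) (S ?l)"
      by (rule qcom_sym) simp_all
    have Sy: "qcom 1 (S ?j) (e y)"
      using S_e[OF jl(1) gens(2)] jl by simp
    have SS: "qcom 1 (S ?j) (S ?l)"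
      using jl by (intro S_comm) auto
    have xJ: "qcom (if godd x \<and> godd y then - \<epsilon> else 1) (e x) (tw y)"
    proof (cases "godd y")
      case True
      have "qcom ((if godd x then - 1 else 1) * (if godd x \<and> godd y then \<epsilon> else 1)) (e x) (S ?l \<otimes> e y)"
        by (intro qcom_mult_right xS xy) simp_all
      with True show ?thesis
        by (simp add: tw_def split: if_splits)
    qed (use xy in \<open>simp add: tw_def\<close>)
    have SJ: "qcom 1 (S ?j) (tw y)"
      using qcom_mult_right[OF SS Sy] Sy by (simp add: tw_def)
    show ?thesis
      using qcom_mult_left[OF SJ xJ] xJ tw_in[OF gens(2)]
      by (cases "godd x"; cases "godd y") (simp_all add: tw_def[of x])
  qed
  \<comment> \<open>The opposite order of indices follows by exchanging the factors, since
    (-\<epsilon>)(-\<epsilon>) = 1.\<close>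
  show ?thesis
  proof (cases "gidx x < gidx y")
    case True
    then show ?thesis using less assms by blast
  next
    case False
    then have "qcom (if godd y \<and> godd x then - \<epsilon> else 1) (tw y) (tw x)"
      using less[of y x] assms by simp
    then show ?thesis
      by (rule qcom_sym) (use eps tw_in assms in auto)
  qed
qed

end

lemma (in cliff2) twist_axioms: "twist B N g (parity B k g) (- 1)"
  by unfold_locales (use g_in s_sq s_comm s_gen qcom_gens in auto)

text \<open>The relations split into those at one index and the sign rule between different indices.
  A twisted family is thus checked by \<open>tw_cliff\<close> and \<open>tw_cross\<close>
  separately.\<close>

lemma cliffI_local:
  fixes B :: "('k::field, 'b) module" (structure)
  assumes "kalg B" and loc: "\<And>a. a \<in> {1..N} \<Longrightarrow> cliff B 1 q k (\<lambda>x. g (gsh a x))"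
    and cross: "\<And>x y. x \<in> gens N \<Longrightarrow> y \<in> gens N \<Longrightarrow> gidx x \<noteq> gidx y \<Longrightarrow>
      kalg.qcom B (if godd x \<and> godd y then - 1 else 1) (g x) (g y)"
  shows "cliff B N q k g"
proof -
  interpret kalg B by fact
  have g_in: "g x \<in> carrier B" if "x \<in> gens N" for x
    using cliff.g_in[OF loc[of "gidx x"], of "gsh 1 x"] that by (cases x) auto
  note loc' = cliff.om_omi[OF loc, of _ 1, simplified] cliff.omi_om[OF loc, of _ 1, simplified]
    cliff.om_psi[OF loc, of _ 1 1, simplified] cliff.om_psiS[OF loc, of _ 1 1, simplified]
    cliff.psi_psi[OF loc, of _ 1 1, simplified] cliff.psiS_psiS[OF loc, of _ 1 1, simplified]
    cliff.psi_psiS_om[OF loc, of _ 1, simplified] cliff.psi_psiS_omi[OF loc, of _ 1, simplified]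
  have even: "g x \<otimes> g y = g y \<otimes> g x"
    if "x \<in> gens N" "y \<in> gens N" "gidx x \<noteq> gidx y" "\<not> godd x" for x y
    using cross[OF that(1-3)] that g_in by (simp add: qcom_def)
  have odd: "g x \<otimes> g y \<oplus> g y \<otimes> g x = \<zero>"
    if "x \<in> gens N" "y \<in> gens N" "gidx x \<noteq> gidx y" "godd x" "godd y" for x y
    using cross[OF that(1-3)] that g_in by (simp add: qcom_minus_one_iff)
  show ?thesis
  proof (unfold_locales, goal_cases)
    case (2 a b)
    then show ?case using even[of "Om a" "Om b"] by (cases "a = b") auto
  next
    case (5 a b)
    then show ?case using even[of "Om a" "Psi b"] g_in loc' by (cases "a = b") auto
  next
    case (6 a b)
    then show ?case using even[of "Om a" "PsiS b"] g_in loc' by (cases "a = b") auto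
  next
    case (7 a b)
    then show ?case using odd[of "Psi a" "Psi b"] loc' by (cases "a = b") auto
  next
    case (8 a b)
    then show ?case using odd[of "PsiS a" "PsiS b"] loc' by (cases "a = b") auto
  next
    case (11 a b)
    then show ?case using odd[of "Psi a" "PsiS b"] by auto
  qed (use g_in loc' in simp_all)
qed

lemma cliff_hom:
  assumes "cliff A N q k g" "kalg B" "alg_hom A B h"
  shows "cliff B N q k (\<lambda>x. h (g x))"
proof -
  interpret cliff A N q k g by fact
  interpret B: kalg B by fact
  note h = alg_hom_mult[OF assms(3), symmetric] alg_hom_add[OF assms(3), symmetric]
    alg_hom_smult[OF assms(3), symmetric] alg_hom_one[OF assms(3), symmetric]
    alg_hom_pow[OF kalg_axioms assms(2,3), symmetric] alg_hom_zero[OF kalg_axioms assms(2,3), symmetric]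
  have [simp]: "g (Psi a) \<in> carrier A" "g (PsiS a) \<in> carrier A" "g (Om a) \<in> carrier A" "g (OmI a) \<in> carrier A"
    if "a \<in> {1..N}" for a
    using that g_in by simp_all
  show ?thesis
  proof (unfold_locales, goal_cases)
    case (1 x)
    then show ?case by (intro alg_hom_closed[OF assms(3)] g_in)
  next
    case (2 a b)
    then show ?case using om_om[of a b] by (simp add: h)
  next
    case (5 a b)
    then show ?case using om_psi[of a b] by (simp add: h)
  next
    case (6 a b)
    then show ?case using om_psiS[of a b] by (simp add: h)
  qed (simp_all add: h om_omi omi_om psi_psi psiS_psiS psi_psiS_omi psi_psiS_om psi_psiS)
qed

section \<open>Tensor powers\<close>

context kalg begin

abbreviation tmult :: "'a list \<Rightarrow> 'a list \<Rightarrow> 'a list" where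
  "tmult \<equiv> \<lambda>s t. map (\<lambda>(x, y). x \<otimes> y) (zip s t)"

lemma tuples_nth: "t \<in> tuples A n \<Longrightarrow> i < n \<Longrightarrow> t ! i \<in> carrier A"
  by (auto simp: tuples_def)

lemma tuples_length: "t \<in> tuples A n \<Longrightarrow> length t = n"
  by (simp add: tuples_def)

lemma tuplesI: "length t = n \<Longrightarrow> (\<And>i. i < n \<Longrightarrow> t ! i \<in> carrier A) \<Longrightarrow> t \<in> tuples A n"
  by (auto simp: tuples_def in_set_conv_nth)

lemma tuples_monoid: "set_monoid (tuples A n) tmult (replicate n \<one>)"
  by unfold_locales
    (auto intro!: tuplesI nth_equalityI simp: tuples_nth tuples_length m_assoc)

lemma tuples_update: "t \<in> tuples A n \<Longrightarrow> x \<in> carrier A \<Longrightarrow> t[j := x] \<in> tuples A n"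
  by (auto simp: tuples_def dest: set_update_subset_insert[THEN subsetD])

lemma tuple_alg_kalg: "kalg (tuple_alg A n)"
  unfolding tuple_alg_def by (rule set_monoid.malg_kalg[OF tuples_monoid])

lemma mlin_rels_in: "mlin_rels A n \<subseteq> carrier (tuple_alg A n)"
  unfolding mlin_rels_def tuple_alg_def
  by (auto intro!: malg_diff_in malg_smult_in delta_in tuples_update)

lemma tens_ideal_ideal: "ideal (tens_ideal A n) (tuple_alg A n)"
  unfolding tens_ideal_def by (rule ring.genideal_ideal[OF _ mlin_rels_in]) (use tuple_alg_kalg in \<open>simp add: kalg_def\<close>)

lemma tens_kalg: "kalg (tens_pow A n)"
  unfolding tens_pow_def by (rule kalg.qalg_kalg[OF tuple_alg_kalg tens_ideal_ideal])

text \<open>The pure tensor with entries \<open>t\<close>.\<close>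

definition tcl :: "nat \<Rightarrow> 'a list \<Rightarrow> ('a list \<Rightarrow> 'k) set" where
  "tcl n t = tens_ideal A n +>\<^bsub>tuple_alg A n\<^esub> delta t"

lemma tens_proj: "alg_hom (tuple_alg A n) (tens_pow A n) (\<lambda>f. tens_ideal A n +>\<^bsub>tuple_alg A n\<^esub> f)"
  unfolding tens_pow_def by (rule kalg.qalg_proj[OF tuple_alg_kalg tens_ideal_ideal])

lemma mlin_hom:
  assumes B: "kalg B" and h: "alg_hom (tuple_alg A n) B h"
    and t: "t \<in> tuples A n" and x: "x \<in> carrier A" and y: "y \<in> carrier A"
  shows "h (\<lambda>s. delta (t[j := x \<oplus> y]) s - delta (t[j := x]) s - delta (t[j := y]) s)
      = h (delta (t[j := x \<oplus> y])) \<ominus>\<^bsub>B\<^esub> h (delta (t[j := x])) \<ominus>\<^bsub>B\<^esub> h (delta (t[j := y]))"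
    and "h (\<lambda>s. delta (t[j := c \<odot> x]) s - c * delta (t[j := x]) s)
      = h (delta (t[j := c \<odot> x])) \<ominus>\<^bsub>B\<^esub> c \<odot>\<^bsub>B\<^esub> h (delta (t[j := x]))"
proof -
  note h' = h[unfolded tuple_alg_def]
  note diff = set_monoid.malg_hom_diff[OF tuples_monoid B h']
  have d: "(delta (t[j := z]) :: _ \<Rightarrow> 'k) \<in> carrier (malg (tuples A n) tmult (replicate n \<one>))" if "z \<in> carrier A" for z
    using t that by (intro delta_in tuples_update)
  show "h (\<lambda>s. delta (t[j := x \<oplus> y]) s - delta (t[j := x]) s - delta (t[j := y]) s)
      = h (delta (t[j := x \<oplus> y])) \<ominus>\<^bsub>B\<^esub> h (delta (t[j := x])) \<ominus>\<^bsub>B\<^esub> h (delta (t[j := y]))"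
    using d x y by (simp add: diff malg_diff_in)
  have "h (\<lambda>s. c * delta (t[j := x]) s) = c \<odot>\<^bsub>B\<^esub> h (delta (t[j := x]))"
    using alg_hom_smult[OF h' d[OF x], of c] by (simp add: malg_ops)
  then show "h (\<lambda>s. delta (t[j := c \<odot> x]) s - c * delta (t[j := x]) s)
      = h (delta (t[j := c \<odot> x])) \<ominus>\<^bsub>B\<^esub> c \<odot>\<^bsub>B\<^esub> h (delta (t[j := x]))"
    using d x by (simp add: diff malg_smult_in)
qed

lemma tcl_in: "t \<in> tuples A n \<Longrightarrow> tcl n t \<in> carrier (tens_pow A n)"
  unfolding tcl_def by (rule alg_hom_closed[OF tens_proj]) (simp add: tuple_alg_def delta_in)

lemma tcl_mult: "s \<in> tuples A n \<Longrightarrow> t \<in> tuples A n \<Longrightarrow> tcl n s \<otimes>\<^bsub>tens_pow A n\<^esub> tcl n t = tcl n (tmult s t)"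
  unfolding tcl_def tens_pow_def tuple_alg_def
  by (rule set_monoid.coset_malg_delta[OF tuples_monoid tens_ideal_ideal[unfolded tuple_alg_def]])

lemma tcl_one: "tcl n (replicate n \<one>) = \<one>\<^bsub>tens_pow A n\<^esub>"
  unfolding tcl_def tens_pow_def tuple_alg_def
  by (rule set_monoid.coset_malg_one[OF tuples_monoid tens_ideal_ideal[unfolded tuple_alg_def]])

lemma mlin_rels_zero:
  assumes "r \<in> mlin_rels A n"
  shows "tens_ideal A n +>\<^bsub>tuple_alg A n\<^esub> r = \<zero>\<^bsub>tens_pow A n\<^esub>"
proof -
  interpret T: kalg "tuple_alg A n" by (rule tuple_alg_kalg)
  have "r \<in> tens_ideal A n"
    unfolding tens_ideal_def using T.genideal_self[OF mlin_rels_in] assms by blast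
  then show ?thesis
    unfolding tens_pow_def using T.coset_zero_iff[OF tens_ideal_ideal] mlin_rels_in assms by blast
qed

lemma tcl_add:
  assumes t: "t \<in> tuples A n" and j: "j < n" and xy: "x \<in> carrier A" "y \<in> carrier A"
  shows "tcl n (t[j := x \<oplus> y]) = tcl n (t[j := x]) \<oplus>\<^bsub>tens_pow A n\<^esub> tcl n (t[j := y])"
proof -
  interpret T: kalg "tens_pow A n" by (rule tens_kalg)
  have in_T: "tcl n (t[j := z]) \<in> carrier (tens_pow A n)" if "z \<in> carrier A" for z
    using t that by (intro tcl_in tuples_update)
  have "(\<lambda>s. delta (t[j := x \<oplus> y]) s - delta (t[j := x]) s - delta (t[j := y]) s) \<in> mlin_rels A n"
    unfolding mlin_rels_def using assms by blast
  from mlin_rels_zero[OF this]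
  have "tcl n (t[j := x \<oplus> y]) \<ominus>\<^bsub>tens_pow A n\<^esub> tcl n (t[j := x]) = tcl n (t[j := y])"
    using mlin_hom(1)[OF tens_kalg tens_proj t xy, of j] in_T xy by (simp add: tcl_def T.r_right_minus_eq)
  then show ?thesis
    using in_T[OF xy(1)] in_T[OF xy(2)] in_T[of "x \<oplus> y"] xy
    by (metis T.a_comm T.add.inv_solve_right' T.minus_eq add.m_closed)
qed

lemma tcl_smult:
  assumes t: "t \<in> tuples A n" and j: "j < n" and x: "x \<in> carrier A"
  shows "tcl n (t[j := c \<odot> x]) = c \<odot>\<^bsub>tens_pow A n\<^esub> tcl n (t[j := x])"
proof -
  interpret T: kalg "tens_pow A n" by (rule tens_kalg)
  have in_T: "tcl n (t[j := z]) \<in> carrier (tens_pow A n)" if "z \<in> carrier A" for z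
    using t that by (intro tcl_in tuples_update)
  have "(\<lambda>s. delta (t[j := c \<odot> x]) s - c * delta (t[j := x]) s) \<in> mlin_rels A n"
    unfolding mlin_rels_def using assms by blast
  from mlin_rels_zero[OF this] show ?thesis
    using mlin_hom(2)[OF tens_kalg tens_proj t x x, of j c] in_T x by (simp add: tcl_def T.r_right_minus_eq)
qed

text \<open>Multiplicativity extends \<phi> to the algebra on tuples, and multilinearity kills the
  relations imposed on it. Maps out of the tensor power are then determined by their values on pure
  tensors.\<close>

lemma tens_universal:
  assumes B: "kalg B" and \<phi>: "\<And>t. t \<in> tuples A n \<Longrightarrow> \<phi> t \<in> carrier B"
    and mult: "\<And>s t. s \<in> tuples A n \<Longrightarrow> t \<in> tuples A n \<Longrightarrow> \<phi> (tmult s t) = \<phi> s \<otimes>\<^bsub>B\<^esub> \<phi> t"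
    and one: "\<phi> (replicate n \<one>) = \<one>\<^bsub>B\<^esub>"
    and add: "\<And>t j x y. t \<in> tuples A n \<Longrightarrow> j < n \<Longrightarrow> x \<in> carrier A \<Longrightarrow> y \<in> carrier A \<Longrightarrow>
      \<phi> (t[j := x \<oplus> y]) = \<phi> (t[j := x]) \<oplus>\<^bsub>B\<^esub> \<phi> (t[j := y])"
    and smult: "\<And>t j x c. t \<in> tuples A n \<Longrightarrow> j < n \<Longrightarrow> x \<in> carrier A \<Longrightarrow>
      \<phi> (t[j := c \<odot> x]) = c \<odot>\<^bsub>B\<^esub> \<phi> (t[j := x])"
  shows "\<exists>h. alg_hom (tens_pow A n) B h \<and> (\<forall>t\<in>tuples A n. h (tcl n t) = \<phi> t)"
proof -
  interpret B: kalg B by fact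
  let ?L = "set_monoid.malg_lift B \<phi>"
  have L: "alg_hom (tuple_alg A n) B ?L"
    unfolding tuple_alg_def by (rule set_monoid.malg_lift_hom[OF tuples_monoid B \<phi> mult one])
  have delta: "?L (delta t) = \<phi> t" if "t \<in> tuples A n" for t
    by (rule set_monoid.malg_lift_delta[OF tuples_monoid B \<phi> mult one]) (assumption | rule that)+
  have zero: "?L r = \<zero>\<^bsub>B\<^esub>" if "r \<in> mlin_rels A n" for r
  proof -
    from that consider t j x y where "t \<in> tuples A n" "j < n" "x \<in> carrier A" "y \<in> carrier A"
        "r = (\<lambda>s. delta (t[j := x \<oplus> y]) s - delta (t[j := x]) s - delta (t[j := y]) s)"
      | t j x c where "t \<in> tuples A n" "j < n" "x \<in> carrier A"
        "r = (\<lambda>s. delta (t[j := c \<odot> x]) s - c * delta (t[j := x]) s)"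
      unfolding mlin_rels_def by blast
    then show ?thesis
    proof cases
      case (1 t j x y)
      have in_B: "\<phi> (t[j := z]) \<in> carrier B" if "z \<in> carrier A" for z
        using 1 that by (intro \<phi> tuples_update)
      have "?L r = \<phi> (t[j := x \<oplus> y]) \<ominus>\<^bsub>B\<^esub> \<phi> (t[j := x]) \<ominus>\<^bsub>B\<^esub> \<phi> (t[j := y])"
        using 1 mlin_hom(1)[OF B L 1(1,3,4), of j] by (simp add: delta tuples_update)
      also have "\<dots> = \<zero>\<^bsub>B\<^esub>"
        using 1 in_B[of x] in_B[of y] B.a_comm[of "\<phi> (t[j := x])" "\<phi> (t[j := y])"]
        by (simp add: add a_minus_def B.a_assoc B.r_neg)
      finally show ?thesis .
    next
      case (2 t j x c)
      then have "\<phi> (t[j := x]) \<in> carrier B"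
        by (intro \<phi> tuples_update)
      then show ?thesis
        using 2 mlin_hom(2)[OF B L 2(1,3,3), of j c]
        by (simp add: delta tuples_update smult B.r_right_minus_eq)
    qed
  qed
  obtain h where h: "alg_hom (tens_pow A n) B h"
    "\<forall>f\<in>carrier (tuple_alg A n). h (tens_ideal A n +>\<^bsub>tuple_alg A n\<^esub> f) = ?L f"
    using kalg.qalg_factor[OF tuple_alg_kalg B L mlin_rels_in zero]
    unfolding tens_pow_def tens_ideal_def by blast
  have "h (tcl n t) = \<phi> t" if "t \<in> tuples A n" for t
    using h(2) that delta by (simp add: tcl_def tuple_alg_def delta_in)
  with h(1) show ?thesis
    by blast
qed

lemma tens_hom_eqI:
  assumes "kalg B" "alg_hom (tens_pow A n) B h" "alg_hom (tens_pow A n) B h'"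
    and "\<And>t. t \<in> tuples A n \<Longrightarrow> h (tcl n t) = h' (tcl n t)" and "y \<in> carrier (tens_pow A n)"
  shows "h y = h' y"
  using set_monoid.qalg_malg_hom_eqI[OF tuples_monoid tens_ideal_ideal[unfolded tuple_alg_def] assms(1)
      assms(2,3)[unfolded tens_pow_def tuple_alg_def] _ assms(5)[unfolded tens_pow_def tuple_alg_def]] assms(4)
  by (simp add: tcl_def tuple_alg_def)

text \<open>Tuples given by functions of the position: list update becomes function update, and
  slotwise products become pointwise ones.\<close>

definition tfun :: "nat \<Rightarrow> (nat \<Rightarrow> 'a) \<Rightarrow> 'a list" where
  "tfun n f = map f [0..<n]"

lemma tfun_nth: "t \<in> tuples A n \<Longrightarrow> tfun n (\<lambda>i. t ! i) = t"
  using map_nth[of t] by (simp add: tfun_def tuples_length)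

lemma tfun_in: "(\<And>i. i < n \<Longrightarrow> f i \<in> carrier A) \<Longrightarrow> tfun n f \<in> tuples A n"
  by (auto simp: tfun_def intro: tuplesI)

lemma tfun_cong: "(\<And>i. i < n \<Longrightarrow> f i = f' i) \<Longrightarrow> tfun n f = tfun n f'"
  by (simp add: tfun_def)

lemma tfun_upd: "tfun n (f(j := x)) = (tfun n f)[j := x]"
  by (rule nth_equalityI) (auto simp: tfun_def nth_list_update)

lemma tcl_tfun_mult:
  assumes "\<And>i. i < n \<Longrightarrow> f i \<in> carrier A" "\<And>i. i < n \<Longrightarrow> f' i \<in> carrier A"
  shows "tcl n (tfun n f) \<otimes>\<^bsub>tens_pow A n\<^esub> tcl n (tfun n f') = tcl n (tfun n (\<lambda>i. f i \<otimes> f' i))"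
proof -
  have "tmult (tfun n f) (tfun n f') = tfun n (\<lambda>i. f i \<otimes> f' i)"
    by (rule nth_equalityI) (auto simp: tfun_def)
  then show ?thesis
    using assms by (simp add: tcl_mult tfun_in)
qed

lemma tcl_tfun_one: "tcl n (tfun n (\<lambda>_. \<one>)) = \<one>\<^bsub>tens_pow A n\<^esub>"
  using tcl_one[of n] by (simp add: tfun_def map_replicate_const)

text \<open>The embedding of the algebra as the factor in slot \<open>j\<close>, counted from 0,
  with units in all other slots.\<close>

definition fac :: "nat \<Rightarrow> nat \<Rightarrow> 'a \<Rightarrow> ('a list \<Rightarrow> 'k) set" where
  "fac n j x = tcl n (tfun n ((\<lambda>_. \<one>)(j := x)))"

lemma fac_hom:
  assumes "j < n"
  shows "alg_hom A (tens_pow A n) (fac n j)"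
proof (rule alg_homI)
  have one: "tfun n (\<lambda>_. \<one>) \<in> tuples A n"
    by (rule tfun_in) simp
  show "fac n j x \<in> carrier (tens_pow A n)" if "x \<in> carrier A" for x
    using that by (auto simp: fac_def intro!: tcl_in tfun_in)
  show "fac n j (x \<otimes> y) = fac n j x \<otimes>\<^bsub>tens_pow A n\<^esub> fac n j y" if "x \<in> carrier A" "y \<in> carrier A" for x y
    unfolding fac_def using that
    by (subst tcl_tfun_mult) (auto intro!: arg_cong[of _ _ "tcl n"] tfun_cong)
  show "fac n j (x \<oplus> y) = fac n j x \<oplus>\<^bsub>tens_pow A n\<^esub> fac n j y" if "x \<in> carrier A" "y \<in> carrier A" for x y
    unfolding fac_def tfun_upd by (rule tcl_add[OF one assms that])
  show "fac n j (c \<odot> x) = c \<odot>\<^bsub>tens_pow A n\<^esub> fac n j x" if "x \<in> carrier A" for c x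
    unfolding fac_def tfun_upd by (rule tcl_smult[OF one assms that])
  show "fac n j \<one> = \<one>\<^bsub>tens_pow A n\<^esub>"
    unfolding fac_def using tcl_tfun_one by (simp add: fun_upd_idem)
qed

text \<open>In every slot at least one of the two entries is the unit, so the slotwise products
  agree in either order, without a sign.\<close>

lemma fac_comm:
  assumes "i \<noteq> j" "x \<in> carrier A" "y \<in> carrier A"
  shows "fac n i x \<otimes>\<^bsub>tens_pow A n\<^esub> fac n j y = fac n j y \<otimes>\<^bsub>tens_pow A n\<^esub> fac n i x"
  unfolding fac_def using assms
  by (subst (1 2) tcl_tfun_mult) (auto intro!: arg_cong[of _ _ "tcl n"] tfun_cong)

lemma lprod_fac:
  assumes "\<And>i. i < n \<Longrightarrow> f i \<in> carrier A"
  shows "lprod (tens_pow A n) (\<lambda>i. fac n i (f i)) n = tcl n (tfun n f)"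
proof -
  \<comment> \<open>A partial product has its first \<open>m\<close> slots filled and units in the
    rest; the next embedding meets only a unit in slot \<open>m\<close>.\<close>
  have "m \<le> n \<Longrightarrow> lprod (tens_pow A n) (\<lambda>i. fac n i (f i)) m = tcl n (tfun n (\<lambda>i. if i < m then f i else \<one>))" for m
  proof (induction m)
    case (Suc m)
    then have "lprod (tens_pow A n) (\<lambda>i. fac n i (f i)) (Suc m)
        = tcl n (tfun n (\<lambda>i. if i < m then f i else \<one>)) \<otimes>\<^bsub>tens_pow A n\<^esub> tcl n (tfun n ((\<lambda>_. \<one>)(m := f m)))"
      by (simp add: fac_def)
    also have "\<dots> = tcl n (tfun n (\<lambda>i. (if i < m then f i else \<one>) \<otimes> ((\<lambda>_. \<one>)(m := f m)) i))"
      using assms Suc.prems by (intro tcl_tfun_mult) auto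
    also have "\<dots> = tcl n (tfun n (\<lambda>i. if i < Suc m then f i else \<one>))"
      using assms by (intro arg_cong[of _ _ "tcl n"] tfun_cong) (auto simp: less_Suc_eq)
    finally show ?case .
  qed (simp add: tcl_tfun_one)
  from this[of n] show ?thesis
    using tfun_cong[of n f "\<lambda>i. if i < n then f i else \<one>"] by simp
qed

end

text \<open>Keeps the 1 in terms such as \<open>Cl q 1 k\<close> from being rewritten to
  \<open>Suc 0\<close>, which would prevent facts about that algebra from matching.\<close>

declare One_nat_def [simp del]

lemma qcom_hom:
  assumes "kalg A" "kalg B" "alg_hom A B h" "x \<in> carrier A" "y \<in> carrier A" "kalg.qcom A c x y"
  shows "kalg.qcom B c (h x) (h y)"
proof -
  interpret A: kalg A by fact
  interpret B: kalg B by fact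
  show ?thesis
    using A.qcomD[OF assms(6)] assms(4,5)
    by (simp add: B.qcom_def alg_hom_mult[OF assms(3), symmetric] alg_hom_smult[OF assms(3), symmetric])
qed

text \<open>The elements commuting with \<open>z\<close> form a subspace closed under products, so
  it suffices to test the images of the generators.\<close>

lemma Cl_hom_comm:
  assumes B: "kalg B" and h: "alg_hom (Cl q N k) B h" and z: "z \<in> carrier B"
    and gen: "\<And>x. x \<in> gens N \<Longrightarrow> kalg.qcom B 1 (h (gcl q N k x)) z"
    and y: "y \<in> carrier (Cl q N k)"
  shows "kalg.qcom B 1 (h y) z"
proof -
  interpret B: kalg B by fact
  interpret C: kalg "Cl q N k" by (rule Cl_kalg)
  let ?V = "{v \<in> carrier B. B.qcom 1 v z}"
  have "subsp B ?V"
    using z by (auto simp: subsp_def B.qcom_add_left B.qcom_smult_left) (simp add: B.qcom_def)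
  moreover have "h (ev (Cl q N k) (gcl q N k) w) \<in> ?V" if "set w \<subseteq> gens N" for w
    using that
  proof (induction w)
    case Nil
    then show ?case using z by (simp add: alg_hom_one[OF h] B.qcom_one_left)
  next
    case (Cons x w)
    have *: "gcl q N k x \<in> carrier (Cl q N k)" "ev (Cl q N k) (gcl q N k) w \<in> carrier (Cl q N k)"
      using Cons.prems by (auto intro!: gcl_in C.ev_in)
    have "B.qcom (1 * 1) (h (gcl q N k x) \<otimes>\<^bsub>B\<^esub> h (ev (Cl q N k) (gcl q N k) w)) z"
      using Cons z gen * by (intro B.qcom_mult_left) (auto intro: alg_hom_closed[OF h])
    then show ?case
      using * by (simp add: alg_hom_mult[OF h] alg_hom_closed[OF h])
  qed
  ultimately have "h y \<in> ?V"
    using y by (rule Cl_hom_image[OF B h])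
  then show ?thesis
    by simp
qed

section \<open>Degrees\<close>

lemma cl_comp_lprod:
  assumes "\<And>i. i < j \<Longrightarrow> f i \<in> cl_comp q N k (d i)"
  shows "lprod (Cl q N k) f j \<in> cl_comp q N k (\<lambda>a. \<Sum>i<j. d i a)"
  using assms
proof (induction j)
  case (Suc j)
  then show ?case
    using cl_comp_mult[of "lprod (Cl q N k) f j" q N k "\<lambda>a. \<Sum>i<j. d i a" "f j" "d j"] by simp
qed (simp add: cl_comp_one)

lemma cl_comp_pow:
  assumes "x \<in> cl_comp q N k (\<lambda>_. 0)"
  shows "x [^]\<^bsub>Cl q N k\<^esub> (i::nat) \<in> cl_comp q N k (\<lambda>_. 0)"
proof (induction i)
  case (Suc i)
  then show ?case
    using cl_comp_mult[OF Suc assms] by (simp add: nat_pow_def)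
qed (simp add: cl_comp_one nat_pow_def)

text \<open>The degrees of psi and psi* cancel, and omega and the unit have degree 0.\<close>

lemma parity_deg:
  assumes "a \<in> {1..N}"
  shows "parity (Cl q N k) k (gcl q N k) a \<in> cl_comp q N k (\<lambda>_. 0)"
proof -
  interpret C: kalg "Cl q N k" by (rule Cl_kalg)
  have om: "gcl q N k (Om a) [^]\<^bsub>Cl q N k\<^esub> k \<in> cl_comp q N k (\<lambda>_. 0)"
    using cl_comp_gen[of "Om a" N q k] assms by (intro cl_comp_pow) (simp add: wdeg_def[abs_def])
  have "(\<lambda>b. wdeg [Psi a] b + wdeg [PsiS a] b) = (\<lambda>_. 0)"
    by (auto simp: wdeg_def)
  then have "gcl q N k (Psi a) \<otimes>\<^bsub>Cl q N k\<^esub> gcl q N k (PsiS a) \<in> cl_comp q N k (\<lambda>_. 0)"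
    using cl_comp_mult[OF cl_comp_gen[of "Psi a" N q k] cl_comp_gen[of "PsiS a" N q k]] assms by simp
  from cl_comp_mult[OF om this] have E: "par_idem (Cl q N k) k (gcl q N k) a \<in> cl_comp q N k (\<lambda>_. 0)"
    by (simp add: par_idem_def)
  have V: "subsp (Cl q N k) (cl_comp q N k (\<lambda>_. 0))"
    by (rule cl_comp_subsp)
  have "parity (Cl q N k) k (gcl q N k) a
      = 2 \<odot>\<^bsub>Cl q N k\<^esub> par_idem (Cl q N k) k (gcl q N k) a \<oplus>\<^bsub>Cl q N k\<^esub> (- 1) \<odot>\<^bsub>Cl q N k\<^esub> \<one>\<^bsub>Cl q N k\<^esub>"
    by (simp add: parity_def a_minus_def C.smult_minus_left)
  then show ?thesis
    using V E cl_comp_one[of q N k] by (simp add: subsp_def)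
qed

lemma tens_comp_subsp: "subsp (tens_pow (Cl q 1 k) n) (tens_comp q n k d)"
proof -
  interpret C: kalg "Cl q 1 k" by (rule Cl_kalg)
  show ?thesis
    unfolding tens_pow_def tens_comp_def tuple_alg_def
    by (rule set_monoid.qcomp_subsp[OF C.tuples_monoid C.tens_ideal_ideal[unfolded tuple_alg_def]])
qed

lemma tens_comp_mult:
  assumes "x \<in> tens_comp q n k d" "y \<in> tens_comp q n k d'"
  shows "x \<otimes>\<^bsub>tens_pow (Cl q 1 k) n\<^esub> y \<in> tens_comp q n k (\<lambda>a. d a + d' a)"
proof -
  interpret C: kalg "Cl q 1 k" by (rule Cl_kalg)
  show ?thesis
    using assms unfolding tens_pow_def tens_comp_def tuple_alg_def
  proof (rule set_monoid.qcomp_mult[OF C.tuples_monoid C.tens_ideal_ideal[unfolded tuple_alg_def], rotated])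
    fix s t
    assume st: "s \<in> tuples (Cl q 1 k) n" "t \<in> tuples (Cl q 1 k) n"
      "\<forall>j<n. s ! j \<in> cl_comp q 1 k (\<lambda>b. if b = 1 then d (Suc j) else 0)"
      "\<forall>j<n. t ! j \<in> cl_comp q 1 k (\<lambda>b. if b = 1 then d' (Suc j) else 0)"
    show "\<forall>j<n. C.tmult s t ! j \<in> cl_comp q 1 k (\<lambda>b. if b = 1 then d (Suc j) + d' (Suc j) else 0)"
    proof (intro allI impI)
      fix j assume j: "j < n"
      have "(\<lambda>b. (if b = 1 then d (Suc j) else 0) + (if b = 1 then d' (Suc j) else 0))
          = (\<lambda>b. if b = (1::nat) then d (Suc j) + d' (Suc j) else 0)"
        by auto
      with j st cl_comp_mult[of "s ! j" q 1 k _ "t ! j"]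
      show "C.tmult s t ! j \<in> cl_comp q 1 k (\<lambda>b. if b = 1 then d (Suc j) + d' (Suc j) else 0)"
        using C.tuples_length[OF st(1)] C.tuples_length[OF st(2)] by fastforce
    qed
  qed
qed

lemma tens_comp_tcl:
  assumes "t \<in> tuples (Cl q 1 k) n"
    and "\<And>j. j < n \<Longrightarrow> t ! j \<in> cl_comp q 1 k (\<lambda>b. if b = 1 then d (Suc j) else 0)"
  shows "kalg.tcl (Cl q 1 k) n t \<in> tens_comp q n k d"
proof -
  interpret C: kalg "Cl q 1 k" by (rule Cl_kalg)
  show ?thesis
    unfolding C.tcl_def tens_comp_def tuple_alg_def
    by (rule set_monoid.qcomp_delta[OF C.tuples_monoid C.tens_ideal_ideal[unfolded tuple_alg_def]]) (use assms in auto)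
qed

lemma tens_comp_hom_image:
  assumes "kalg B" "alg_hom (tens_pow (Cl q 1 k) n) B h" "subsp B V"
    and "\<And>t. t \<in> tuples (Cl q 1 k) n \<Longrightarrow>
      (\<And>j. j < n \<Longrightarrow> t ! j \<in> cl_comp q 1 k (\<lambda>b. if b = 1 then d (Suc j) else 0)) \<Longrightarrow>
      h (kalg.tcl (Cl q 1 k) n t) \<in> V"
    and "y \<in> tens_comp q n k d"
  shows "h y \<in> V"
proof -
  interpret C: kalg "Cl q 1 k" by (rule Cl_kalg)
  show ?thesis
    by (rule set_monoid.qcomp_hom_image[OF C.tuples_monoid C.tens_ideal_ideal[unfolded tuple_alg_def] assms(1)
          assms(2)[unfolded tens_pow_def tuple_alg_def] assms(3) _ assms(5)[unfolded tens_comp_def tuple_alg_def]])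
      (use assms(4) in \<open>simp add: C.tcl_def tuple_alg_def\<close>)
qed

lemma tens_comp_one: "\<one>\<^bsub>tens_pow (Cl q 1 k) n\<^esub> \<in> tens_comp q n k (\<lambda>_. 0)"
proof -
  interpret C: kalg "Cl q 1 k" by (rule Cl_kalg)
  have z: "(\<lambda>b. if b = 1 then (0::int) else 0) = (\<lambda>_::nat. 0)"
    by auto
  have "C.tcl n (replicate n \<one>\<^bsub>Cl q 1 k\<^esub>) \<in> tens_comp q n k (\<lambda>_. 0)"
    by (rule tens_comp_tcl) (use cl_comp_one[of q 1 k] in \<open>auto intro!: C.tuplesI simp: z\<close>)
  then show ?thesis
    by (simp add: C.tcl_one)
qed

text \<open>Slot \<open>j\<close> carries the value of the degree at \<open>Suc j\<close>; the other
  slots hold the unit and need degree 0 there.\<close>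

lemma tens_comp_fac:
  assumes x: "x \<in> carrier (Cl q 1 k)" "x \<in> cl_comp q 1 k (\<lambda>b. if b = 1 then d (Suc j) else 0)"
    and d: "\<And>i. i < n \<Longrightarrow> i \<noteq> j \<Longrightarrow> d (Suc i) = 0"
  shows "kalg.fac (Cl q 1 k) n j x \<in> tens_comp q n k d"
proof -
  interpret C: kalg "Cl q 1 k" by (rule Cl_kalg)
  have z: "(\<lambda>b. if b = 1 then (0::int) else 0) = (\<lambda>_::nat. 0)"
    by auto
  show ?thesis
    unfolding C.fac_def
  proof (rule tens_comp_tcl)
    show "C.tfun n ((\<lambda>_. \<one>\<^bsub>Cl q 1 k\<^esub>)(j := x)) \<in> tuples (Cl q 1 k) n"
      using x by (auto intro: C.tfun_in)
    fix i assume "i < n"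
    then show "C.tfun n ((\<lambda>_. \<one>\<^bsub>Cl q 1 k\<^esub>)(j := x)) ! i \<in> cl_comp q 1 k (\<lambda>b. if b = 1 then d (Suc i) else 0)"
      using x d[of i] cl_comp_one[of q 1 k] z by (cases "i = j") (auto simp: C.tfun_def cong: if_cong)
  qed
qed

lemma tens_comp_lprod:
  assumes "\<And>i. i < j \<Longrightarrow> f i \<in> tens_comp q n k (\<lambda>_. 0)"
  shows "lprod (tens_pow (Cl q 1 k) n) f j \<in> tens_comp q n k (\<lambda>_. 0)"
  using assms
proof (induction j)
  case (Suc j)
  then show ?case
    using tens_comp_mult[of "lprod (tens_pow (Cl q 1 k) n) f j" q n k "\<lambda>_. 0" "f j" "\<lambda>_. 0"] by simp
qed (simp add: tens_comp_one)

lemma tens_comp_ev: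
  assumes "\<And>x. x \<in> set w \<Longrightarrow> f x \<in> tens_comp q n k (wdeg [x])"
  shows "ev (tens_pow (Cl q 1 k) n) f w \<in> tens_comp q n k (wdeg w)"
  using assms
proof (induction w)
  case Nil
  then show ?case using tens_comp_one[of q k n] by (simp add: wdeg_def[abs_def])
next
  case (Cons x w)
  have "wdeg (x # w) = (\<lambda>a. wdeg [x] a + wdeg w a)"
    using wdeg_append[of "[x]" w] by auto
  then show ?case
    using Cons tens_comp_mult[of "f x" q n k "wdeg [x]" "ev (tens_pow (Cl q 1 k) n) f w" "wdeg w"] by simp
qed

text \<open>Meant for the images of a word in index-1 generators under an embedding of
  \<open>Cl q 1 k\<close> at index \<open>b\<close>: its single degree moves to coordinate
  \<open>b\<close>.\<close>

lemma cl_comp_ev_shift: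
  assumes "\<And>x. x \<in> set w \<Longrightarrow> f x \<in> cl_comp q N k (wdeg [gsh b x])" and "set w \<subseteq> gens 1"
  shows "ev (Cl q N k) f w \<in> cl_comp q N k (\<lambda>a. if a = b then wdeg w 1 else 0)"
  using assms
proof (induction w)
  case Nil
  have "(\<lambda>a. if a = b then wdeg [] 1 else 0) = (\<lambda>_. 0)"
    by (auto simp: wdeg_def)
  then show ?case using cl_comp_one[of q N k] by simp
next
  case (Cons x w)
  then have "gidx x = 1"
    by (auto simp: gens_gidx)
  then have "(\<lambda>a. wdeg [gsh b x] a + (if a = b then wdeg w 1 else 0)) = (\<lambda>a. if a = b then wdeg (x # w) 1 else 0)"
    by (cases x) (auto simp: wdeg_def fun_eq_iff)
  then show ?case
    using Cons cl_comp_mult[of "f x" q N k "wdeg [gsh b x]" "ev (Cl q N k) f w" "\<lambda>a. if a = b then wdeg w 1 else 0"]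
    by simp
qed

section \<open>The isomorphism\<close>

lemma lprod_single:
  assumes "kalg A" "j < n" "x \<in> carrier A"
  shows "lprod A ((\<lambda>_. \<one>\<^bsub>A\<^esub>)(j := x)) n = x"
proof -
  interpret kalg A by fact
  have "lprod A ((\<lambda>_. \<one>\<^bsub>A\<^esub>)(j := x)) m = (if j < m then x else \<one>\<^bsub>A\<^esub>)" for m
    by (induction m) (use assms in \<open>auto simp: less_Suc_eq\<close>)
  with assms show ?thesis by simp
qed

theorem Cl_graded_iso_tens_pow:
  fixes q :: "'k::field" and n k :: nat
  assumes two: "(2::'k) \<noteq> 0" and q0: "q \<noteq> 0"
  shows "\<exists>f. graded_alg_iso (Cl q n k) (tens_pow (Cl q 1 k) n) n
                (cl_comp q n k) (tens_comp q n k) f"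
proof -
  let ?C = "Cl q 1 k" and ?D = "Cl q n k" and ?T = "tens_pow (Cl q 1 k) n"
  let ?c = "gcl q 1 k" and ?g = "gcl q n k"
  interpret C: cliff2 ?C 1 q k ?c
    using two q0 Cl_cliff by (simp add: cliff2_def cliff2_axioms_def)
  interpret D: cliff2 ?D n q k ?g
    using two q0 Cl_cliff by (simp add: cliff2_def cliff2_axioms_def)
  interpret T: kalg ?T
    by (rule C.tens_kalg)
  let ?\<sigma> = "parity ?C k ?c 1"
  have \<sigma>_in: "?\<sigma> \<in> carrier ?C"
    by (rule C.s_in) simp
  \<comment> \<open>The untwisted generators of the tensor power: index a is placed in slot a - 1 as
    a copy of the index-1 generator, and \<sigma> is the parity element of that slot.\<close>
  define e where "e x = C.fac n (gidx x - 1) (?c (gsh 1 x))" for x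
  define \<sigma> where "\<sigma> a = C.fac n (a - 1) ?\<sigma>" for a
  have c_in: "?c (gsh 1 x) \<in> carrier ?C" for x
    by (rule C.g_in) (simp add: gens_gidx)
  have fac_in: "C.fac n j x \<in> carrier ?T" if "j < n" "x \<in> carrier ?C" for j x
    using alg_hom_closed[OF C.fac_hom] that by blast
  have fac_comm: "T.qcom 1 (C.fac n i x) (C.fac n j y)"
    if "i \<noteq> j" "i < n" "j < n" "x \<in> carrier ?C" "y \<in> carrier ?C" for i j x y
    using C.fac_comm[OF that(1,4,5), of n] that fac_in by (simp add: T.qcom_def)
  \<comment> \<open>The two instances of the twist: sign -1 for the Clifford generators here, sign 1
    for the commuting slots in the next interpretation.\<close>
  interpret DT: twist ?D n ?g "parity ?D k ?g" "- 1"
    by (rule D.twist_axioms)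
  interpret TT: twist ?T n e \<sigma> 1
  proof unfold_locales
    fix x assume "x \<in> gens n"
    then show "e x \<in> carrier ?T"
      unfolding e_def by (intro fac_in c_in) (auto simp: gens_gidx)
  next
    fix a assume a: "a \<in> {1..n}"
    then show "\<sigma> a \<in> carrier ?T"
      unfolding \<sigma>_def by (intro fac_in \<sigma>_in) auto
    have "a - 1 < n"
      using a by auto
    then show "\<sigma> a \<otimes>\<^bsub>?T\<^esub> \<sigma> a = \<one>\<^bsub>?T\<^esub>"
      using C.s_sq[of 1] \<sigma>_in
      by (simp add: \<sigma>_def alg_hom_mult[OF C.fac_hom, symmetric] alg_hom_one[OF C.fac_hom])
  next
    fix a b assume ab: "a \<in> {1..n}" "b \<in> {1..n}"
    show "T.qcom 1 (\<sigma> a) (\<sigma> b)"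
    proof (cases "a = b")
      case True
      have "\<sigma> b \<in> carrier ?T"
        unfolding \<sigma>_def using ab by (intro fac_in \<sigma>_in) auto
      with True show ?thesis by (simp add: T.qcom_def)
    next
      case False
      with ab show ?thesis
        unfolding \<sigma>_def by (intro fac_comm \<sigma>_in) auto
    qed
  next
    fix a x assume ax: "a \<in> {1..n}" "x \<in> gens n"
    show "T.qcom (if godd x \<and> gidx x = a then - 1 else 1) (\<sigma> a) (e x)"
    proof (cases "gidx x = a")
      case True
      have "C.qcom (if godd (gsh 1 x) \<and> gidx (gsh 1 x) = 1 then - 1 else 1) ?\<sigma> (?c (gsh 1 x))"
        by (rule C.s_gen) (simp_all add: gens_gidx)
      then have "C.qcom (if godd x then - 1 else 1) ?\<sigma> (?c (gsh 1 x))"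
        by simp
      with True show ?thesis
        unfolding \<sigma>_def e_def using ax
        by (simp, intro conjI impI)
          (rule qcom_hom[OF C.kalg_axioms C.tens_kalg C.fac_hom \<sigma>_in c_in], auto)+
    next
      case False
      with ax have "T.qcom 1 (\<sigma> a) (e x)"
        unfolding \<sigma>_def e_def by (intro fac_comm \<sigma>_in c_in) (auto simp: gens_gidx)
      with False show ?thesis by simp
    qed
  next
    fix x y assume "x \<in> gens n" "y \<in> gens n" "gidx x \<noteq> gidx y"
    then have "T.qcom 1 (e x) (e y)"
      unfolding e_def by (intro fac_comm c_in) (auto simp: gens_gidx)
    then show "T.qcom (if godd x \<and> godd y then 1 else 1) (e x) (e y)"
      by simp
  qed simp

  have e_gsh: "e (gsh (Suc j) x) = C.fac n j (?c (gsh 1 x))" for j x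
    by (cases x) (simp_all add: e_def)
  have e_cliff: "cliff ?T 1 q k (\<lambda>x. e (gsh a x))" if "a \<in> {1..n}" for a
  proof -
    obtain j where j: "a = Suc j" "j < n"
      using \<open>a \<in> {1..n}\<close> by (cases a) auto
    show ?thesis
      using cliff_hom[OF C.restrict_cliff C.tens_kalg C.fac_hom[OF j(2)], of 1] by (simp add: j(1) e_gsh)
  qed
  \<comment> \<open>Twisting turns commuting slots into anticommuting generators, which defines
    \<Phi>.\<close>
  have "cliff ?T n q k TT.tw"
    by (rule cliffI_local[OF C.tens_kalg TT.tw_cliff[OF _ e_cliff] TT.tw_cross])
  from Cl_universal[OF this]
  obtain \<Phi> where \<Phi>: "alg_hom ?D ?T \<Phi>" and \<Phi>_gen: "\<And>x. x \<in> gens n \<Longrightarrow> \<Phi> (?g x) = TT.tw x"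
    by blast

  \<comment> \<open>In the other direction, the twisted generators of index \<open>Suc j\<close>
    span off a copy of \<open>Cl q 1 k\<close> for each slot.\<close>
  have "\<exists>h. alg_hom ?C ?D h \<and> (\<forall>x\<in>gens 1. h (?c x) = DT.tw (gsh (Suc j) x))" if "j < n" for j
    by (rule Cl_universal[OF DT.tw_cliff[OF _ D.restrict_cliff]]) (use that in auto)
  then obtain \<iota> where \<iota>: "\<And>j. j < n \<Longrightarrow> alg_hom ?C ?D (\<iota> j)"
    and \<iota>_gen: "\<And>j x. j < n \<Longrightarrow> x \<in> gens 1 \<Longrightarrow> \<iota> j (?c x) = DT.tw (gsh (Suc j) x)"
    by metis
  have \<iota>_in: "\<iota> j x \<in> carrier ?D" if "j < n" "x \<in> carrier ?C" for j x
    using alg_hom_closed[OF \<iota>] that by blast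
  \<comment> \<open>Commutation of two images is reduced to generators by applying
    \<open>Cl_hom_comm\<close> once for each side; on twisted generators the sign is -(-1) =
    1.\<close>
  have \<iota>_comm: "D.qcom 1 (\<iota> i x) (\<iota> j y)"
    if ij: "i < n" "j < n" "i \<noteq> j" and xy: "x \<in> carrier ?C" "y \<in> carrier ?C" for i j x y
  proof (rule Cl_hom_comm[OF D.kalg_axioms \<iota>[OF ij(1)] \<iota>_in[OF ij(2) xy(2)] _ xy(1)])
    fix u assume u: "u \<in> gens 1"
    have cu: "\<iota> i (?c u) \<in> carrier ?D"
      using \<iota>_in[OF ij(1) C.g_in[OF u]] .
    have "D.qcom 1 (\<iota> j y) (\<iota> i (?c u))"
    proof (rule Cl_hom_comm[OF D.kalg_axioms \<iota>[OF ij(2)] cu _ xy(2)])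
      fix v assume v: "v \<in> gens 1"
      have "D.qcom (if godd (gsh (Suc j) v) \<and> godd (gsh (Suc i) u) then - (- 1) else 1)
          (DT.tw (gsh (Suc j) v)) (DT.tw (gsh (Suc i) u))"
        using ij by (intro DT.tw_cross) (auto simp: gens_gidx)
      then show "D.qcom 1 (\<iota> j (?c v)) (\<iota> i (?c u))"
        using ij u v by (simp add: \<iota>_gen split: if_splits)
    qed
    then show "D.qcom 1 (\<iota> i (?c u)) (\<iota> j y)"
      by (rule D.qcom_one_sym[OF _ \<iota>_in[OF ij(2) xy(2)] cu])
  qed
  \<comment> \<open>Although \<iota> sends generators to twisted ones, \<open>tw_parity\<close>
    gives back the untwisted parity element. Hence \<Psi> will match the strings of the two
    algebras.\<close>
  have \<iota>_\<sigma>: "\<iota> j ?\<sigma> = parity ?D k ?g (Suc j)" if "j < n" for j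
  proof -
    have "\<iota> j ?\<sigma> = parity ?D k (\<lambda>x. \<iota> j (?c x)) 1"
      by (rule parity_hom[OF C.kalg_axioms D.kalg_axioms \<iota>[OF that]]) simp_all
    also have "\<dots> = parity ?D k DT.tw (Suc j)"
      using that by (simp add: parity_def par_idem_def \<iota>_gen)
    also have "\<dots> = parity ?D k ?g (Suc j)"
      using that by (intro DT.tw_parity) auto
    finally show ?thesis .
  qed

  have nth_in: "t ! i \<in> carrier ?C" if "t \<in> tuples ?C n" "i < n" for t i
    using that by (rule C.tuples_nth)
  \<comment> \<open>The candidate for \<Psi> on pure tensors; it is multiplicative because the
    images of different slots commute.\<close>
  define \<phi> where "\<phi> t = lprod ?D (\<lambda>i. \<iota> i (t ! i)) n" for t
  have \<phi>_update: "\<phi> (t[j := x]) = lprod ?D ((\<lambda>i. \<iota> i (t ! i))(j := \<iota> j x)) n"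
    if "t \<in> tuples ?C n" for t j x
    unfolding \<phi>_def using C.tuples_length[OF that] by (intro lprod_cong) (auto simp: nth_list_update)
  have "\<exists>h. alg_hom ?T ?D h \<and> (\<forall>t\<in>tuples ?C n. h (C.tcl n t) = \<phi> t)"
  proof (rule C.tens_universal[OF D.kalg_axioms])
    show "\<phi> t \<in> carrier ?D" if "t \<in> tuples ?C n" for t
      unfolding \<phi>_def using that by (intro D.lprod_in \<iota>_in nth_in)
    show "\<phi> (C.tmult s t) = \<phi> s \<otimes>\<^bsub>?D\<^esub> \<phi> t" if st: "s \<in> tuples ?C n" "t \<in> tuples ?C n" for s t
    proof -
      have "\<phi> (C.tmult s t) = lprod ?D (\<lambda>i. \<iota> i (s ! i) \<otimes>\<^bsub>?D\<^esub> \<iota> i (t ! i)) n"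
        unfolding \<phi>_def using st C.tuples_length[OF st(1)] C.tuples_length[OF st(2)]
        by (intro lprod_cong) (simp add: alg_hom_mult[OF \<iota>] nth_in)
      also have "\<dots> = \<phi> s \<otimes>\<^bsub>?D\<^esub> \<phi> t"
        unfolding \<phi>_def using st by (intro D.lprod_mult \<iota>_comm \<iota>_in nth_in) auto
      finally show ?thesis .
    qed
    have "\<phi> (replicate n \<one>\<^bsub>?C\<^esub>) = lprod ?D (\<lambda>_. \<one>\<^bsub>?D\<^esub>) n"
      unfolding \<phi>_def by (intro lprod_cong) (simp add: alg_hom_one[OF \<iota>])
    then show "\<phi> (replicate n \<one>\<^bsub>?C\<^esub>) = \<one>\<^bsub>?D\<^esub>"
      by (simp add: D.lprod_one)
    show "\<phi> (t[j := x \<oplus>\<^bsub>?C\<^esub> y]) = \<phi> (t[j := x]) \<oplus>\<^bsub>?D\<^esub> \<phi> (t[j := y])"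
      if "t \<in> tuples ?C n" "j < n" "x \<in> carrier ?C" "y \<in> carrier ?C" for t j x y
      unfolding \<phi>_update[OF that(1)] alg_hom_add[OF \<iota>[OF that(2)] that(3,4)]
      using that by (intro D.lprod_add \<iota>_in nth_in)
    show "\<phi> (t[j := c \<odot>\<^bsub>?C\<^esub> x]) = c \<odot>\<^bsub>?D\<^esub> \<phi> (t[j := x])"
      if "t \<in> tuples ?C n" "j < n" "x \<in> carrier ?C" for t j x c
      unfolding \<phi>_update[OF that(1)] alg_hom_smult[OF \<iota>[OF that(2)] that(3)]
      using that by (intro D.lprod_smult \<iota>_in nth_in)
  qed
  then obtain \<Psi> where \<Psi>: "alg_hom ?T ?D \<Psi>" and \<Psi>_tcl: "\<And>t. t \<in> tuples ?C n \<Longrightarrow> \<Psi> (C.tcl n t) = \<phi> t"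
    by blast
  have \<Psi>_fac: "\<Psi> (C.fac n j x) = \<iota> j x" if "j < n" "x \<in> carrier ?C" for j x
  proof -
    have "\<Psi> (C.fac n j x) = \<phi> (C.tfun n ((\<lambda>_. \<one>\<^bsub>?C\<^esub>)(j := x)))"
      unfolding C.fac_def using that by (intro \<Psi>_tcl C.tfun_in) auto
    also have "\<dots> = lprod ?D ((\<lambda>_. \<one>\<^bsub>?D\<^esub>)(j := \<iota> j x)) n"
      unfolding \<phi>_def by (intro lprod_cong) (auto simp: C.tfun_def alg_hom_one[OF \<iota>])
    also have "\<dots> = \<iota> j x"
      using that by (intro lprod_single D.kalg_axioms \<iota>_in)
    finally show ?thesis .
  qed

  have \<Psi>_S: "\<Psi> (TT.S j) = DT.S j" if "j \<le> n" for j
  proof -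
    have "\<Psi> (TT.S j) = lprod ?D (\<lambda>i. \<Psi> (\<sigma> (Suc i))) j"
      using that by (intro alg_hom_lprod[OF T.kalg_axioms \<Psi>] TT.s_in) auto
    also have "\<dots> = DT.S j"
      using that \<sigma>_in by (intro lprod_cong) (simp add: \<sigma>_def \<Psi>_fac \<iota>_\<sigma>)
    finally show ?thesis .
  qed
  have \<Psi>_e: "\<Psi> (e x) = DT.tw x" if "x \<in> gens n" for x
  proof -
    have "gidx x - 1 < n" "gsh (Suc (gidx x - 1)) (gsh 1 x) = x"
      using that by (cases x; auto simp: gens_gidx)+
    then show ?thesis
      using c_in[of x] \<iota>_gen[of "gidx x - 1" "gsh 1 x"] by (simp add: e_def \<Psi>_fac gens_gidx)
  qed
  \<comment> \<open>On an odd generator, \<Phi> multiplies by a string and \<Psi> turns the result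
    into the corresponding string times the twisted generator; the two equal strings cancel by
    \<open>S_tw\<close>.\<close>
  have \<Psi>\<Phi>: "\<Psi> (\<Phi> y) = y" if "y \<in> carrier ?D" for y
  proof (rule Cl_hom_eqI[OF D.kalg_axioms alg_hom_comp[OF \<Phi> \<Psi>] _ _ that])
    show "alg_hom ?D ?D (\<lambda>y. y)"
      by (rule alg_homI) simp_all
    fix x assume x: "x \<in> gens n"
    then have j: "gidx x - 1 \<le> n"
      by (auto simp: gens_gidx)
    show "\<Psi> (\<Phi> (?g x)) = ?g x"
    proof (cases "godd x")
      case True
      have "\<Psi> (\<Phi> (?g x)) = DT.S (gidx x - 1) \<otimes>\<^bsub>?D\<^esub> DT.tw x"
        using True x j by (simp add: \<Phi>_gen TT.tw_def alg_hom_mult[OF \<Psi>] TT.e_in \<Psi>_S \<Psi>_e)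
      then show ?thesis
        using DT.S_tw[OF x True] by simp
    next
      case False
      then show ?thesis
        using x by (simp add: \<Phi>_gen TT.tw_def \<Psi>_e DT.tw_def)
    qed
  qed

  \<comment> \<open>The mirror image of the computation for \<iota>: \<Phi> produces twisted
    generators, whose parity elements are again the untwisted ones.\<close>
  have \<Phi>_s: "\<Phi> (parity ?D k ?g a) = \<sigma> a" if "a \<in> {1..n}" for a
  proof -
    have a: "a - 1 < n" "Suc (a - 1) = a"
      using that by auto
    have "\<Phi> (parity ?D k ?g a) = parity ?T k (\<lambda>x. \<Phi> (?g x)) a"
      by (rule parity_hom[OF D.kalg_axioms T.kalg_axioms \<Phi>]) (use that in simp_all)
    also have "\<dots> = parity ?T k TT.tw a"
      using that by (simp add: parity_def par_idem_def \<Phi>_gen)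
    also have "\<dots> = parity ?T k e a"
      by (rule TT.tw_parity[OF that])
    also have "\<dots> = parity ?T k (\<lambda>x. C.fac n (a - 1) (?c x)) 1"
      by (simp add: parity_def par_idem_def e_def)
    also have "\<dots> = \<sigma> a"
      unfolding \<sigma>_def
      by (rule parity_hom[OF C.kalg_axioms T.kalg_axioms C.fac_hom, symmetric]) (use a in simp_all)
    finally show ?thesis .
  qed
  have \<Phi>_S: "\<Phi> (DT.S j) = TT.S j" if "j \<le> n" for j
  proof -
    have "\<Phi> (DT.S j) = lprod ?T (\<lambda>i. \<Phi> (parity ?D k ?g (Suc i))) j"
      using that by (intro alg_hom_lprod[OF D.kalg_axioms \<Phi>] DT.s_in) auto
    also have "\<dots> = TT.S j"
      using that by (intro lprod_cong) (simp add: \<Phi>_s)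
    finally show ?thesis .
  qed
  \<comment> \<open>The same cancellation of strings, now in the tensor power; since pure tensors
    are ordered products of the embedded factors, it settles the other composite.\<close>
  have \<Phi>_\<iota>: "\<Phi> (\<iota> j y) = C.fac n j y" if j: "j < n" and y: "y \<in> carrier ?C" for j y
  proof (rule Cl_hom_eqI[OF T.kalg_axioms alg_hom_comp[OF \<iota>[OF j] \<Phi>] C.fac_hom[OF j] _ y])
    fix x assume x: "x \<in> gens 1"
    let ?x = "gsh (Suc j) x"
    have "gsh 1 x = x"
      using x by (cases x) (auto simp: gens_gidx)
    then have e: "e ?x = C.fac n j (?c x)"
      by (simp add: e_gsh)
    have x': "?x \<in> gens n"
      using j by (simp add: gens_gidx)
    show "\<Phi> (\<iota> j (?c x)) = C.fac n j (?c x)"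
    proof (cases "godd ?x")
      case True
      have "\<Phi> (\<iota> j (?c x)) = TT.S (gidx ?x - 1) \<otimes>\<^bsub>?T\<^esub> TT.tw ?x"
        using True x x' j by (simp add: \<iota>_gen DT.tw_def alg_hom_mult[OF \<Phi>] D.g_in \<Phi>_S \<Phi>_gen)
      then show ?thesis
        using TT.S_tw[OF x' True] e by simp
    next
      case False
      then show ?thesis
        using x x' j e by (simp add: \<iota>_gen DT.tw_def \<Phi>_gen TT.tw_def)
    qed
  qed
  have \<Phi>\<Psi>: "\<Phi> (\<Psi> y) = y" if "y \<in> carrier ?T" for y
  proof (rule C.tens_hom_eqI[OF T.kalg_axioms alg_hom_comp[OF \<Psi> \<Phi>] _ _ that])
    show "alg_hom ?T ?T (\<lambda>y. y)"
      by (rule alg_homI) simp_all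
    fix t assume t: "t \<in> tuples ?C n"
    have "\<Phi> (\<Psi> (C.tcl n t)) = lprod ?T (\<lambda>i. \<Phi> (\<iota> i (t ! i))) n"
      using t unfolding \<Psi>_tcl[OF t] \<phi>_def by (intro alg_hom_lprod[OF D.kalg_axioms \<Phi>] \<iota>_in nth_in)
    also have "\<dots> = lprod ?T (\<lambda>i. C.fac n i (t ! i)) n"
      using t by (intro lprod_cong \<Phi>_\<iota> nth_in)
    also have "\<dots> = C.tcl n t"
      using C.lprod_fac[of n "\<lambda>i. t ! i"] t by (simp add: nth_in C.tfun_nth)
    finally show "\<Phi> (\<Psi> (C.tcl n t)) = C.tcl n t" .
  qed

  have "bij_betw \<Phi> (carrier ?D) (carrier ?T)"
    by (rule bij_betw_byWitness[of _ \<Psi>])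
      (use \<Psi>\<Phi> \<Phi>\<Psi> alg_hom_closed[OF \<Phi>] alg_hom_closed[OF \<Psi>] in auto)
  then have iso: "\<Phi> \<in> ring_iso ?D ?T"
    using \<Phi> by (simp add: ring_iso_def alg_hom_def)

  have S_deg: "DT.S j \<in> cl_comp q n k (\<lambda>_. 0)" if "j \<le> n" for j
    using cl_comp_lprod[of j "\<lambda>i. parity ?D k ?g (Suc i)" q n k "\<lambda>_ _. 0"] that parity_deg[of _ n q k] by simp
  have tw_deg: "DT.tw x \<in> cl_comp q n k (wdeg [x])" if "x \<in> gens n" for x
  proof -
    have "gidx x - 1 \<le> n"
      using that by (auto simp: gens_gidx)
    then show ?thesis
      using cl_comp_mult[OF S_deg cl_comp_gen[OF that]] cl_comp_gen[OF that, of q k] by (simp add: DT.tw_def)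
  qed
  have TS_deg: "TT.S j \<in> tens_comp q n k (\<lambda>_. 0)" if "j \<le> n" for j
    using parity_deg[of 1 1 q k] \<sigma>_in that
    by (intro tens_comp_lprod) (auto simp: \<sigma>_def intro!: tens_comp_fac cong: if_cong)
  have e_deg: "e x \<in> tens_comp q n k (wdeg [x])" if "x \<in> gens n" for x
  proof -
    have "wdeg [gsh 1 x] = (\<lambda>b. if b = 1 then wdeg [x] (Suc (gidx x - 1)) else 0)"
      using that by (cases x) (auto simp: wdeg_def fun_eq_iff gens_gidx)
    moreover have "wdeg [x] (Suc i) = 0" if "i < n" "i \<noteq> gidx x - 1" for i
      using that \<open>x \<in> gens n\<close> by (cases x) (auto simp: wdeg_def)
    moreover have "gsh 1 x \<in> gens 1"
      by (simp add: gens_gidx)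
    ultimately show ?thesis
      unfolding e_def using cl_comp_gen[of "gsh 1 x" 1 q k] c_in by (intro tens_comp_fac) auto
  qed
  have Ttw_deg: "TT.tw x \<in> tens_comp q n k (wdeg [x])" if "x \<in> gens n" for x
  proof -
    have "gidx x - 1 \<le> n"
      using that by (auto simp: gens_gidx)
    then show ?thesis
      using tens_comp_mult[OF TS_deg e_deg[OF that]] e_deg[OF that] by (simp add: TT.tw_def)
  qed
  have \<Phi>_deg: "\<Phi> y \<in> tens_comp q n k d" if "y \<in> cl_comp q n k d" for y d
  proof (rule cl_comp_hom_image[OF T.kalg_axioms \<Phi> tens_comp_subsp _ that])
    fix w assume w: "set w \<subseteq> gens n" "wdeg w = d"
    have "\<Phi> (ev ?D ?g w) = ev ?T (\<lambda>x. \<Phi> (?g x)) w"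
      using w D.g_in by (intro alg_hom_ev[OF D.kalg_axioms \<Phi>]) auto
    moreover have "ev ?T (\<lambda>x. \<Phi> (?g x)) w \<in> tens_comp q n k (wdeg w)"
      using w Ttw_deg \<Phi>_gen by (intro tens_comp_ev) auto
    ultimately show "\<Phi> (ev ?D ?g w) \<in> tens_comp q n k d"
      using w by simp
  qed
  have \<iota>_deg: "\<iota> j y \<in> cl_comp q n k (\<lambda>a. if a = Suc j then c else 0)"
    if "j < n" "y \<in> cl_comp q 1 k (\<lambda>b. if b = 1 then c else 0)" for j y c
  proof (rule cl_comp_hom_image[OF D.kalg_axioms \<iota>[OF that(1)] cl_comp_subsp _ that(2)])
    fix w assume w: "set w \<subseteq> gens 1" "wdeg w = (\<lambda>b. if b = 1 then c else 0)"
    have "\<iota> j (ev ?C ?c w) = ev ?D (\<lambda>x. \<iota> j (?c x)) w"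
      using w C.g_in by (intro alg_hom_ev[OF C.kalg_axioms \<iota>[OF that(1)]]) auto
    moreover have "ev ?D (\<lambda>x. \<iota> j (?c x)) w \<in> cl_comp q n k (\<lambda>a. if a = Suc j then wdeg w 1 else 0)"
    proof (rule cl_comp_ev_shift[OF _ w(1)])
      fix x assume "x \<in> set w"
      then show "\<iota> j (?c x) \<in> cl_comp q n k (wdeg [gsh (Suc j) x])"
        using w that tw_deg[of "gsh (Suc j) x"] by (auto simp: \<iota>_gen gens_gidx subset_iff)
    qed
    ultimately show "\<iota> j (ev ?C ?c w) \<in> cl_comp q n k (\<lambda>a. if a = Suc j then c else 0)"
      using w by (simp cong: if_cong)
  qed
  have \<Psi>_deg: "\<Psi> y \<in> cl_comp q n k d"
    if "y \<in> tens_comp q n k d" and d: "\<forall>a. d a \<noteq> 0 \<longrightarrow> a \<in> {1..n}" for y d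
  proof (rule tens_comp_hom_image[OF D.kalg_axioms \<Psi> cl_comp_subsp _ that(1)])
    fix t assume t: "t \<in> tuples ?C n"
      "\<And>j. j < n \<Longrightarrow> t ! j \<in> cl_comp q 1 k (\<lambda>b. if b = 1 then d (Suc j) else 0)"
    have "lprod ?D (\<lambda>i. \<iota> i (t ! i)) n \<in> cl_comp q n k (\<lambda>a. \<Sum>i<n. if a = Suc i then d (Suc i) else 0)"
      using t by (intro cl_comp_lprod \<iota>_deg)
    \<comment> \<open>The slots see only the values of \<open>d\<close> at 1 to \<open>n\<close>.
      The support condition on \<open>d\<close> makes the sum agree with \<open>d\<close> everywhere
      else, including at 0.\<close>
    moreover have "(\<lambda>a. \<Sum>i<n. if a = Suc i then d (Suc i) else 0) = d"
    proof
      fix a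
      show "(\<Sum>i<n. if a = Suc i then d (Suc i) else 0) = d a"
        using d by (cases a) (auto simp: sum.delta)
    qed
    ultimately show "\<Psi> (C.tcl n t) \<in> cl_comp q n k d"
      by (simp add: \<Psi>_tcl[OF t(1)] \<phi>_def)
  qed
  have "\<Phi> ` cl_comp q n k d = tens_comp q n k d" if "\<forall>a. d a \<noteq> 0 \<longrightarrow> a \<in> {1..n}" for d
  proof
    show "\<Phi> ` cl_comp q n k d \<subseteq> tens_comp q n k d"
      using \<Phi>_deg by blast
    \<comment> \<open>Surjectivity on components requires a homogeneous preimage; \<Psi> supplies
      one because it preserves degrees as well.\<close>
    show "tens_comp q n k d \<subseteq> \<Phi> ` cl_comp q n k d"
    proof
      fix y assume y: "y \<in> tens_comp q n k d"
      then have "y \<in> carrier ?T"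
        using tens_comp_subsp[of q k n d] by (auto simp: subsp_def)
      then have "\<Phi> (\<Psi> y) = y"
        by (rule \<Phi>\<Psi>)
      with \<Psi>_deg[OF y that] show "y \<in> \<Phi> ` cl_comp q n k d"
        by (metis imageI)
    qed
  qed
  then show ?thesis
    using iso alg_hom_smult[OF \<Phi>] unfolding graded_alg_iso_def by blast
qed

theorem corollary3p11:
  fixes q :: "'k::field" and n k :: nat
  assumes "CHAR('k) \<noteq> 2" and "q \<noteq> 0" and "0 < n" and "0 < k"
  shows "\<exists>f. graded_alg_iso (Cl q n k) (tens_pow (Cl q 1 k) n) n
                (cl_comp q n k) (tens_comp q n k) f"
proof (rule Cl_graded_iso_tens_pow)
  show "(2::'k) \<noteq> 0"
  proof
    assume "(2::'k) = 0"
    \<comment> \<open>A characteristic dividing the prime 2 is 1 or 2; the value 1 would identify 0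
      and 1.\<close>
    then have "CHAR('k) dvd 2"
      using of_nat_eq_0_iff_char_dvd[of 2, where 'a = 'k] by simp
    moreover have "CHAR('k) \<noteq> 1"
      by (metis of_nat_1 of_nat_CHAR zero_neq_one)
    ultimately show False
      using assms(1) prime_nat_iff two_is_prime_nat by blast
  qed
qed fact

end
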